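(* Given a graph $G$ and an integer $k$, one can construct in polynomial time a 1-planar graph $H$ such that $G$ has a feedback vertex set of size at most $k$ if and only if $H$ has a feedback vertex set of size at most $k$.
   Context: All graphs are finite and undirected. A feedback vertex set of a graph is a set of vertices whose removal leaves an acyclic graph. A graph is 1-planar if it can be drawn in the Euclidean plane such that every edge is crossed at most once. *)

theory Defs
  imports "HOL-Analysis.Analysis" "HOL-Computational_Algebra.Polynomial"
begin

subsection \<open>Graphs and feedback vertex sets\<close>

datatype 'a graph = Graph (verts: "'a set") (edges: "'a set set")

definition simple_graph :: "'a graph \<Rightarrow> bool" where
  "simple_graph G \<longleftrightarrow> finite (verts G) \<and> (\<forall>e\<in>edges G. e \<subseteq> verts G \<and> card e = 2)"

definition delete_verts :: "'a graph \<Rightarrow> 'a set \<Rightarrow> 'a graph" where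
  "delete_verts G S = Graph (verts G - S) {e \<in> edges G. e \<inter> S = {}}"

definition is_cycle :: "'a graph \<Rightarrow> 'a list \<Rightarrow> bool" where
  "is_cycle G c \<longleftrightarrow> 3 \<le> length c \<and> distinct c \<and> set c \<subseteq> verts G \<and>
     (\<forall>i<length c. {c ! i, c ! (Suc i mod length c)} \<in> edges G)"

definition acyclic_graph :: "'a graph \<Rightarrow> bool" where
  "acyclic_graph G \<longleftrightarrow> (\<nexists>c. is_cycle G c)"

definition feedback_vertex_set :: "'a graph \<Rightarrow> 'a set \<Rightarrow> bool" where
  "feedback_vertex_set G S \<longleftrightarrow> S \<subseteq> verts G \<and> acyclic_graph (delete_verts G S)"


subsection \<open>1-planar graphs\<close>

definition drawing :: "'a graph \<Rightarrow> ('a \<Rightarrow> real^2) \<Rightarrow> ('a set \<Rightarrow> real \<Rightarrow> real^2) \<Rightarrow> bool" where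
  "drawing G pos \<gamma> \<longleftrightarrow> inj_on pos (verts G) \<and>
     (\<forall>e\<in>edges G. arc (\<gamma> e) \<and> {pathstart (\<gamma> e), pathfinish (\<gamma> e)} = pos ` e \<and>
        path_image (\<gamma> e) \<inter> pos ` verts G = pos ` e)"

definition edge_interior :: "('a \<Rightarrow> real^2) \<Rightarrow> ('a set \<Rightarrow> real \<Rightarrow> real^2) \<Rightarrow> 'a set \<Rightarrow> (real^2) set" where
  "edge_interior pos \<gamma> e = path_image (\<gamma> e) - pos ` e"

text \<open>Every common interior point of two edges counts as a crossing. Recording the other edge along
  with the point means that several edges passing through one point are counted separately.\<close>

definition crossings ::
    "'a graph \<Rightarrow> ('a \<Rightarrow> real^2) \<Rightarrow> ('a set \<Rightarrow> real \<Rightarrow> real^2) \<Rightarrow> 'a set \<Rightarrow> ('a set \<times> (real^2)) set" where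
  "crossings G pos \<gamma> e =
     {(f, p). f \<in> edges G \<and> f \<noteq> e \<and> p \<in> edge_interior pos \<gamma> e \<inter> edge_interior pos \<gamma> f}"

definition one_planar :: "'a graph \<Rightarrow> bool" where
  "one_planar G \<longleftrightarrow> (\<exists>pos \<gamma>. drawing G pos \<gamma> \<and>
     (\<forall>e\<in>edges G. finite (crossings G pos \<gamma> e) \<and> card (crossings G pos \<gamma> e) \<le> 1))"


subsection \<open>Polynomial-time computability\<close>

text \<open>Programs for a random access machine with natural-number registers and an unbounded,
  indirectly addressed memory. The only arithmetic is addition and truncated subtraction, so an
  instruction increases the bit length of the largest stored number by at most one (up to the
  constants in the program). Hence the unit-cost running time is polynomially related to
  Turing machine time. Output is emitted one bit per step, so its length is bounded by the
  running time.\<close>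

datatype com =
    Skip
  | Const nat nat
  | Add nat nat nat
  | Sub nat nat nat
  | Load nat nat
  | Store nat nat
  | Emit nat
  | Seq com com
  | Cond nat com com
  | While nat com

record state =
  regs :: "nat \<Rightarrow> nat"
  mem :: "nat \<Rightarrow> nat"
  outp :: "bool list"

text \<open>\<open>exec c s t s'\<close>: started in state \<open>s\<close>, program \<open>c\<close> halts in state \<open>s'\<close> after \<open>t\<close> steps.\<close>

inductive exec :: "com \<Rightarrow> state \<Rightarrow> nat \<Rightarrow> state \<Rightarrow> bool" where
  Skip: "exec Skip s 1 s"
| Const: "exec (Const r n) s 1 (s\<lparr>regs := (regs s)(r := n)\<rparr>)"
| Add: "exec (Add r a b) s 1 (s\<lparr>regs := (regs s)(r := regs s a + regs s b)\<rparr>)"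
| Sub: "exec (Sub r a b) s 1 (s\<lparr>regs := (regs s)(r := regs s a - regs s b)\<rparr>)"
| Load: "exec (Load r a) s 1 (s\<lparr>regs := (regs s)(r := mem s (regs s a))\<rparr>)"
| Store: "exec (Store a r) s 1 (s\<lparr>mem := (mem s)(regs s a := regs s r)\<rparr>)"
| Emit: "exec (Emit r) s 1 (s\<lparr>outp := outp s @ [regs s r \<noteq> 0]\<rparr>)"
| Seq: "exec c s t s' \<Longrightarrow> exec d s' u s'' \<Longrightarrow> exec (Seq c d) s (t + u) s''"
| CondTrue: "regs s r \<noteq> 0 \<Longrightarrow> exec c s t s' \<Longrightarrow> exec (Cond r c d) s (Suc t) s'"
| CondFalse: "regs s r = 0 \<Longrightarrow> exec d s t s' \<Longrightarrow> exec (Cond r c d) s (Suc t) s'"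
| WhileTrue: "regs s r \<noteq> 0 \<Longrightarrow> exec c s t s' \<Longrightarrow> exec (While r c) s' u s'' \<Longrightarrow>
    exec (While r c) s (Suc (t + u)) s''"
| WhileFalse: "regs s r = 0 \<Longrightarrow> exec (While r c) s 1 s"

inductive_cases exec_elims:
  "exec Skip s t s'" "exec (Const r n) s t s'" "exec (Add r a b) s t s'" "exec (Sub r a b) s t s'"
  "exec (Load r a) s t s'" "exec (Store a r) s t s'" "exec (Emit r) s t s'"

inductive_cases exec_SeqE: "exec (Seq c d) s t s'"
inductive_cases exec_CondE: "exec (Cond r c d) s t s'"
inductive_cases exec_WhileE: "exec (While r c) s t s'"

lemma exec_deterministic: "exec c s t s' \<Longrightarrow> exec c s u s'' \<Longrightarrow> t = u \<and> s' = s''"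
proof (induction arbitrary: u s'' rule: exec.induct)
  case Seq
  from Seq.prems show ?case
    by (rule exec_SeqE) (metis Seq.IH neq0_conv)+
next
  case CondTrue
  from CondTrue.prems show ?case
    by (rule exec_CondE) (metis CondTrue.IH CondTrue.hyps neq0_conv)+
next
  case CondFalse
  from CondFalse.prems show ?case
    by (rule exec_CondE) (metis CondFalse.IH CondFalse.hyps neq0_conv)+
next
  case WhileTrue
  from WhileTrue.prems show ?case
    by (rule exec_WhileE) (metis WhileTrue.IH WhileTrue.hyps neq0_conv)+
next
  case WhileFalse
  from WhileFalse.prems show ?case
    by (rule exec_WhileE) (use WhileFalse.hyps in simp_all)
qed (erule exec_elims; simp)+

definition init_state :: "bool list \<Rightarrow> state" where
  "init_state xs = \<lparr>regs = (\<lambda>_. 0)(0 := length xs),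
     mem = (\<lambda>i. if i < length xs then of_bool (xs ! i) else 0), outp = []\<rparr>"

definition polytime_computable ::
    "('a \<Rightarrow> bool list) \<Rightarrow> ('b \<Rightarrow> bool list) \<Rightarrow> 'a set \<Rightarrow> ('a \<Rightarrow> 'b) \<Rightarrow> bool" where
  "polytime_computable enc_in enc_out A f \<longleftrightarrow>
     (\<exists>c (p :: nat poly). \<forall>x\<in>A. \<exists>t s. exec c (init_state (enc_in x)) t s \<and>
        t \<le> poly p (length (enc_in x)) \<and> outp s = enc_out (f x))"


subsection \<open>Encoding of instances\<close>

text \<open>Algorithms operate on graphs with vertex set \<open>{0,\<dots>,n-1}\<close>, given by \<open>n\<close> in unary followed by
  the adjacency matrix. Integers are given by a sign bit and the binary digits of the absolute
  value, least significant digit first.\<close>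

definition labelled_graph :: "nat graph \<Rightarrow> bool" where
  "labelled_graph G \<longleftrightarrow> simple_graph G \<and> (\<exists>n. verts G = {..<n})"

definition enc_graph :: "nat graph \<Rightarrow> bool list" where
  "enc_graph G = (let n = card (verts G) in
     replicate n True @ [False] @ [{i, j} \<in> edges G. i \<leftarrow> [0..<n], j \<leftarrow> [0..<n]])"

fun enc_nat :: "nat \<Rightarrow> bool list" where
  "enc_nat n = (if n = 0 then [] else odd n # enc_nat (n div 2))"

declare enc_nat.simps [simp del]

definition enc_int :: "int \<Rightarrow> bool list" where
  "enc_int k = (k < 0) # enc_nat (nat \<bar>k\<bar>)"

definition enc_instance :: "nat graph \<times> int \<Rightarrow> bool list" where
  "enc_instance = (\<lambda>(G, k). enc_graph G @ enc_int k)"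

end

theory Submission imports Defs begin

text \<open>\<open>H\<close> arises from \<open>G\<close> by subdividing every edge \<open>L\<close> times, where \<open>L\<close> is the length of the input; the
  cycles of \<open>H\<close> correspond to those of \<open>G\<close>, and a subdivision vertex in a feedback vertex set can be
  replaced by an end of its edge. To draw \<open>H\<close>, put vertex \<open>i\<close> at
  \<open>(i, 0)\<close> and draw the edge from \<open>i\<close> to \<open>j\<close> as the parabola \<open>y = c * (x - i) * (j - x)\<close> with its own
  coefficient \<open>c > 0\<close>. Any two of the parabolas meet at most twice, and for generic coefficients no three
  meet in one point above the axis. Each edge therefore has at most \<open>n\<^sup>2 \<le> L\<close> crossings, and its
  subdivision vertices can be placed between consecutive ones. Existence of the drawing suffices: the
  algorithm only prints the adjacency matrix of \<open>H\<close>.\<close>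

section \<open>Feedback vertex sets of subdivisions\<close>

text \<open>The machine can neither multiply nor divide, and this shapes \<open>H\<close>. Its
  vertices are all triples \<open>(i, j, t)\<close> with \<open>i, j < n\<close> and
  \<open>t < L\<close>, numbered lexicographically, so that nested counting loops print its size and
  its matrix, and each entry depends on a few comparisons. The price is the triples on no path; as
  isolated vertices they lie on no cycle. Edges are subdivided equally often, whether crossed or
  not, so that the program is independent of the drawing. The input length is a convenient
  \<open>L\<close>: it is at hand in register 0, it exceeds \<open>n * n\<close>, and loops that run
  at most \<open>L\<close> times, nested to a fixed depth, take polynomial time. Genericity is
  needed because a crossing is counted as a pair of another edge and a point: with three arches
  through one point, an edge would have two crossings there however finely it is subdivided.\<close>

text \<open>Cycles are replaced by nonempty edge sets without vertices of degree one, which are easier to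
  transport along subdivisions.\<close>

definition core :: "'a set set \<Rightarrow> bool" where
  "core F \<longleftrightarrow> F \<noteq> {} \<and> (\<forall>e\<in>F. \<forall>v\<in>e. \<exists>e'\<in>F. e' \<noteq> e \<and> v \<in> e')"

text \<open>Each vertex of the cycle lies on the edge that enters it and on the edge that leaves it;
  length at least 3 makes these two different.\<close>

lemma core_of_cycle:
  assumes c: "is_cycle G c"
  shows "\<exists>F\<subseteq>edges G. core F"
proof -
  let ?l = "length c"
  define nxt where "nxt i = Suc i mod ?l" for i
  define pe where "pe i = {c ! i, c ! nxt i}" for i
  have l: "3 \<le> ?l" and d: "distinct c" and E: "\<And>i. i < ?l \<Longrightarrow> pe i \<in> edges G"
    using c by (auto simp: is_cycle_def pe_def nxt_def)
  have nxt_less: "nxt i < ?l" for i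
    unfolding nxt_def using l by (intro mod_less_divisor) linarith
  have ne: "pe i \<noteq> pe (nxt i)" if "i < ?l" for i
  proof -
    have "nxt i \<noteq> i" "nxt (nxt i) \<noteq> i" "nxt (nxt i) \<noteq> nxt i"
      using that l by (auto simp: mod_Suc nxt_def)
    then show ?thesis
      using that nxt_less d by (auto simp: pe_def doubleton_eq_iff nth_eq_iff_index_eq)
  qed
  have step: "\<exists>e'\<in>pe ` {..<?l}. e' \<noteq> pe i \<and> v \<in> e'" if i: "i < ?l" and v: "v \<in> pe i" for i v
  proof (cases "v = c ! i")
    case True
    define j where "j = (if i = 0 then ?l - 1 else i - 1)"
    have j: "j < ?l" "nxt j = i" using i l by (auto simp: j_def nxt_def)
    then show ?thesis using ne[OF j(1)] True by (intro bexI[of _ "pe j"]) (auto simp: pe_def)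
  next
    case False
    then show ?thesis using ne[OF i] v nxt_less by (intro bexI[of _ "pe (nxt i)"]) (auto simp: pe_def)
  qed
  have "core (pe ` {..<?l})" unfolding core_def
  proof (intro conjI ballI)
    have "0 < ?l" using l by linarith
    then show "pe ` {..<?l} \<noteq> {}" by blast
  next
    fix e v assume "e \<in> pe ` {..<?l}" and v: "v \<in> e"
    then obtain i where "i < ?l" "e = pe i" by blast
    with step v show "\<exists>e'\<in>pe ` {..<?l}. e' \<noteq> e \<and> v \<in> e'" by blast
  qed
  with E show ?thesis by (intro exI[of _ "pe ` {..<?l}"]) auto
qed

text \<open>Take a longest path along \<open>F\<close>. The core property gives its first vertex a
  second edge, whose other end lies on the path by maximality, and this closes a cycle.\<close>

lemma cycle_of_core:
  assumes G: "simple_graph G" and F: "F \<subseteq> edges G" "core F"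
  shows "\<exists>c. is_cycle G c"
proof -
  define P where "P p \<longleftrightarrow> 2 \<le> length p \<and> distinct p \<and> set p \<subseteq> verts G \<and>
    (\<forall>i. Suc i < length p \<longrightarrow> {p ! i, p ! Suc i} \<in> F)" for p
  have card2: "card e = 2" "e \<subseteq> verts G" if "e \<in> F" for e using G F that by (auto simp: simple_graph_def)
  obtain e where e: "e \<in> F" using F by (auto simp: core_def)
  then obtain a b where "e = {a, b}" "a \<noteq> b" using card2 card_2_iff by metis
  then have ex: "P [a, b]" using e card2[OF e] by (auto simp: P_def)
  have bound: "length p \<le> card (verts G)" if "P p" for p
    using that G distinct_card[of p] card_mono[of "verts G" "set p"] by (auto simp: P_def simple_graph_def)
  obtain p where p: "P p" and max: "\<And>q. P q \<Longrightarrow> length q \<le> length p"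
    using ex_has_greatest_nat[of P "[a, b]" length "Suc (card (verts G))"] ex bound le_imp_less_Suc by blast
  have l: "2 \<le> length p" and d: "distinct p" and V: "set p \<subseteq> verts G"
    and E: "\<And>i. Suc i < length p \<Longrightarrow> {p ! i, p ! Suc i} \<in> F" using p by (auto simp: P_def)
  have "{p ! 0, p ! 1} \<in> F" using E[of 0] l by auto
  then obtain e' where e': "e' \<in> F" "e' \<noteq> {p ! 0, p ! 1}" "p ! 0 \<in> e'"
    using F(2) unfolding core_def by blast
  then obtain u where u: "e' = {p ! 0, u}" "u \<noteq> p ! 0"
    using card2[OF e'(1)] by (auto simp: card_2_iff doubleton_eq_iff)
  have "u \<in> set p"
  proof (rule ccontr)
    assume n: "u \<notin> set p"
    have "P (u # p)" unfolding P_def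
    proof (intro conjI allI impI)
      fix i assume "Suc i < length (u # p)"
      then show "{(u # p) ! i, (u # p) ! Suc i} \<in> F"
        using e' u E by (cases i) (auto simp: insert_commute)
    qed (use n l d V u e' card2 in auto)
    then show False using max by fastforce
  qed
  then obtain m where m: "m < length p" "p ! m = u" by (auto simp: in_set_conv_nth)
  \<comment> \<open>Positions 0 and 1 are excluded because the new edge is no loop and differs from
    the first edge of the path. Hence the cycle has length at least 3.\<close>
  have m2: "2 \<le> m" proof (rule ccontr)
    assume "\<not> 2 \<le> m"
    then have "m = 0 \<or> m = 1" by linarith
    then show False using u e' m by auto
  qed
  let ?c = "take (Suc m) p"
  have lc: "length ?c = Suc m" using m by auto
  have "{?c ! i, ?c ! (Suc i mod length ?c)} \<in> edges G" if i: "i < length ?c" for i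
  proof (cases "i = m")
    case True
    then show ?thesis using lc m e' u F(1) by (auto simp: insert_commute)
  next
    case False
    then have "Suc i < length p" "Suc i mod length ?c = Suc i" "i < Suc m" "Suc i < Suc m" using lc i m by auto
    then show ?thesis using E[of i] F(1) by auto
  qed
  then have "is_cycle G ?c" using d V lc m2 by (auto simp: is_cycle_def dest: in_set_takeD)
  then show ?thesis ..
qed

text \<open>Deleting \<open>S\<close> keeps exactly the edges that avoid \<open>S\<close>, so the
  cores of the remaining graph are the cores of \<open>G\<close> that avoid \<open>S\<close>. Cycles
  do not occur again after this.\<close>

lemma feedback_vertex_set_iff_core:
  assumes G: "simple_graph G"
  shows "feedback_vertex_set G S \<longleftrightarrow>
    S \<subseteq> verts G \<and> \<not> (\<exists>F\<subseteq>edges G. core F \<and> (\<forall>e\<in>F. e \<inter> S = {}))"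
proof -
  have "simple_graph (delete_verts G S)" using G by (auto simp: simple_graph_def delete_verts_def)
  then have "(\<exists>c. is_cycle (delete_verts G S) c) \<longleftrightarrow> (\<exists>F\<subseteq>edges (delete_verts G S). core F)"
    by (metis core_of_cycle cycle_of_core)
  moreover have "F \<subseteq> edges (delete_verts G S) \<and> core F \<longleftrightarrow>
      F \<subseteq> edges G \<and> core F \<and> (\<forall>e\<in>F. e \<inter> S = {})" for F
    by (auto simp: delete_verts_def)
  ultimately show ?thesis by (simp add: feedback_vertex_set_def acyclic_graph_def)
qed

section \<open>Numbering the vertices of the subdivision\<close>

definition code :: "nat \<Rightarrow> nat \<Rightarrow> nat \<Rightarrow> nat \<Rightarrow> nat \<Rightarrow> nat" where
  "code n L i j t = (i * n + j) * L + t"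

lemma code_less:
  assumes "i < n" "j < n" "t < L"
  shows "code n L i j t < n * n * L"
proof -
  have m: "a * m + b < l * m" if "a < l" "b < m" for a b l m :: nat
  proof -
    have "Suc a * m \<le> l * m" using that by (intro mult_le_mono1) auto
    with that show ?thesis by simp
  qed
  show ?thesis using assms by (simp add: code_def m)
qed

text \<open>This gives the projection to \<open>G\<close>: division by \<open>n * L\<close> sends an
  original vertex to itself and an inner vertex of a path to the smaller end of its edge.\<close>

lemma code_div:
  assumes "j < n" "t < L"
  shows "code n L i j t div (n * L) = i"
proof -
  have "code n L i j t div (n * L) = ((i * n + j) * L + t) div L div n"
    by (simp add: code_def div_mult2_eq mult.commute)
  then show ?thesis using assms by simp
qed

lemma code_inject:
  assumes "j < n" "t < L" "j' < n" "t' < L"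
  shows "code n L i j t = code n L i' j' t' \<longleftrightarrow> i = i' \<and> j = j' \<and> t = t'"
proof
  assume eq: "code n L i j t = code n L i' j' t'"
  then have "((i * n + j) * L + t) mod L = ((i' * n + j') * L + t') mod L"
    "((i * n + j) * L + t) div L = ((i' * n + j') * L + t') div L" by (auto simp: code_def)
  then have "t = t'" "i * n + j = i' * n + j'" using assms by auto
  then have "(i * n + j) mod n = (i' * n + j') mod n" by simp
  with \<open>t = t'\<close> assms show "i = i' \<and> j = j' \<and> t = t'" using eq code_div by (metis mod_mult_self3 mod_less)
qed auto

text \<open>\<open>node n L (i, j) 0, \<dots>, node n L (i, j) (L + 1)\<close> is the path that replaces the edge from \<open>i\<close> to \<open>j\<close>;
  the triples \<open>(i, i, 0)\<close> stand for the original vertices. Triples on no path are isolated vertices of the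
  subdivided graph.\<close>

definition node :: "nat \<Rightarrow> nat \<Rightarrow> nat \<times> nat \<Rightarrow> nat \<Rightarrow> nat" where
  "node n L p k = (if k = 0 then code n L (fst p) (fst p) 0
     else if k = Suc L then code n L (snd p) (snd p) 0
     else code n L (fst p) (snd p) (k - 1))"

definition link :: "nat \<Rightarrow> nat \<Rightarrow> nat \<times> nat \<Rightarrow> nat \<Rightarrow> nat set" where
  "link n L p k = {node n L p k, node n L p (Suc k)}"

definition arcs :: "nat \<Rightarrow> nat set set \<Rightarrow> (nat \<times> nat) set" where
  "arcs n E = {(i, j). i < j \<and> j < n \<and> {i, j} \<in> E}"

definition subdivide :: "nat \<Rightarrow> nat \<Rightarrow> nat set set \<Rightarrow> nat graph" where
  "subdivide n L E = Graph {..<n * n * L} {link n L p k | p k. p \<in> arcs n E \<and> k \<le> L}"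

lemma arcsD: "p \<in> arcs n E \<Longrightarrow> fst p < snd p \<and> snd p < n \<and> fst p < n \<and> {fst p, snd p} \<in> E"
  by (auto simp: arcs_def)

text \<open>Since \<open>fst p < snd p\<close>, the inner triples stay off the diagonal, where the
  original vertices sit. Only ends can therefore be shared by different paths.\<close>

lemma node_eq_iff:
  assumes "p \<in> arcs n E" "q \<in> arcs n E'" "k \<le> Suc L" "l \<le> Suc L" "0 < L"
  shows "node n L p k = node n L q l \<longleftrightarrow>
    (if k \<in> {0, Suc L} \<and> l \<in> {0, Suc L}
     then (if k = 0 then fst p else snd p) = (if l = 0 then fst q else snd q)
     else k = l \<and> p = q)"
  using arcsD[OF assms(1)] arcsD[OF assms(2)] assms(3-5)
  by (auto simp: node_def code_inject prod_eq_iff)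

lemma node_less: "p \<in> arcs n E \<Longrightarrow> k \<le> Suc L \<Longrightarrow> 0 < L \<Longrightarrow> node n L p k < n * n * L"
  using arcsD[of p n E] by (auto simp: node_def code_less)

lemma node_div:
  assumes "p \<in> arcs n E" "k \<le> Suc L" "0 < L"
  shows "node n L p k div (n * L) \<in> {fst p, snd p}"
  using arcsD[OF assms(1)] assms by (auto simp: node_def code_div)

lemma simple_subdivide:
  assumes "0 < L"
  shows "simple_graph (subdivide n L E)"
proof -
  have "node n L p k \<noteq> node n L p (Suc k)" if "p \<in> arcs n E" "k \<le> L" for p k
    using that assms arcsD[OF that(1)] by (subst node_eq_iff) auto
  then show ?thesis using assms
    by (auto simp: simple_graph_def subdivide_def link_def card_2_iff intro: node_less) (metis)
qed

text \<open>Inner nodes thus have degree two, which lets a core spread from one link along the whole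
  path.\<close>

lemma inner_node_in_link:
  assumes "p \<in> arcs n E" "q \<in> arcs n E" "0 < k" "k \<le> L" "l \<le> L" "node n L p k \<in> link n L q l"
  shows "q = p \<and> (l = k \<or> Suc l = k)"
  using assms by (auto simp: link_def node_eq_iff)

lemma link_inject:
  assumes "p \<in> arcs n E" "q \<in> arcs n E" "k \<le> L" "l \<le> L" "0 < L"
  shows "link n L p k = link n L q l \<longleftrightarrow> p = q \<and> k = l"
proof
  assume eq: "link n L p k = link n L q l"
  \<comment> \<open>Because \<open>0 < L\<close>, every link has an inner end, and an inner node
    determines its path.\<close>
  let ?k = "if k = 0 then Suc k else k"
  have "node n L p ?k \<in> link n L q l" unfolding eq[symmetric] by (auto simp: link_def)
  then have "q = p" using inner_node_in_link[of p n E q ?k L l] assms by auto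
  then show "p = q \<and> k = l" using eq assms arcsD[OF assms(1)]
    by (auto simp: link_def doubleton_eq_iff node_eq_iff split: if_splits)
qed auto

section \<open>Transporting feedback vertex sets between a graph and its subdivision\<close>

text \<open>A core of the subdivision consists of entire paths. Contracting each path to its edge
  gives a core of the original graph, and it avoids \<open>S\<close> if the first core avoids the
  copies of \<open>S\<close>.\<close>

lemma fvs_subdivide_imp:
  assumes G: "simple_graph (Graph {..<n} E)" and L: "0 < L"
    and S: "feedback_vertex_set (Graph {..<n} E) S"
  shows "feedback_vertex_set (subdivide n L E) ((\<lambda>i. code n L i i 0) ` S)"
proof -
  let ?S = "(\<lambda>i. code n L i i 0) ` S"
  note A = arcsD[of _ n E]
  have SV: "S \<subseteq> {..<n}" using S by (auto simp: feedback_vertex_set_def)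
  have False if F': "F' \<subseteq> edges (subdivide n L E)" "core F'" "\<forall>e\<in>F'. e \<inter> ?S = {}" for F'
  proof -
    have edge: "\<exists>p\<in>arcs n E. \<exists>k\<le>L. e = link n L p k" if "e \<in> F'" for e
      using F'(1) that unfolding subdivide_def graph.sel by blast
    have other: "\<exists>q\<in>arcs n E. \<exists>l\<le>L. link n L q l \<in> F' \<and> link n L q l \<noteq> e \<and> v \<in> link n L q l"
      if "e \<in> F'" "v \<in> e" for e v
      using F'(2) that edge unfolding core_def by metis
    have step: "link n L p k \<in> F' \<longleftrightarrow> link n L p (Suc k) \<in> F'" if "p \<in> arcs n E" "Suc k \<le> L" for p k
    proof
      assume "link n L p k \<in> F'"
      then show "link n L p (Suc k) \<in> F'"
        using other[of "link n L p k" "node n L p (Suc k)"] inner_node_in_link[OF that(1) _ _ that(2)]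
        by (auto simp: link_def)
    next
      assume "link n L p (Suc k) \<in> F'"
      then show "link n L p k \<in> F'"
        using other[of "link n L p (Suc k)" "node n L p (Suc k)"] inner_node_in_link[OF that(1) _ _ that(2)]
        by (auto simp: link_def)
    qed
    have base: "link n L p k \<in> F' \<longleftrightarrow> link n L p 0 \<in> F'" if "p \<in> arcs n E" "k \<le> L" for p k
      using that by (induction k) (auto simp: step[symmetric])
    have all: "link n L p k \<in> F' \<longleftrightarrow> link n L p l \<in> F'" if "p \<in> arcs n E" "k \<le> L" "l \<le> L" for p k l
      using base that by metis
    \<comment> \<open>By \<open>base\<close> the first link stands for the whole path.\<close>
    define F where "F = {{fst p, snd p} | p. p \<in> arcs n E \<and> link n L p 0 \<in> F'}"
    obtain p0 k0 where "p0 \<in> arcs n E" "k0 \<le> L" "link n L p0 k0 \<in> F'"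
      using F'(2) edge unfolding core_def by (metis ex_in_conv)
    then have "F \<noteq> {}" unfolding F_def using base by blast
    moreover have "\<exists>e'\<in>F. e' \<noteq> e \<and> v \<in> e'" if eF: "e \<in> F" and ve: "v \<in> e" for e v
    proof -
      obtain p where p: "e = {fst p, snd p}" "p \<in> arcs n E" "link n L p 0 \<in> F'"
        using eF unfolding F_def by blast
      have pL: "link n L p L \<in> F'" using p base[OF p(2) le_refl] by simp
      have "\<exists>q\<in>arcs n E. q \<noteq> p \<and> link n L q 0 \<in> F' \<and> v \<in> {fst q, snd q}"
      proof (cases "v = fst p")
        case True
        obtain q l where q: "q \<in> arcs n E" "l \<le> L" "link n L q l \<in> F'" "link n L q l \<noteq> link n L p 0"
          "node n L p 0 \<in> link n L q l"
          using other[OF p(3), of "node n L p 0"] unfolding link_def[of n L p] by blast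
        \<comment> \<open>Link 0 is the only link of \<open>p\<close> at its start, so the second
          link found there belongs to another path.\<close>
        have "q \<noteq> p \<and> v \<in> {fst q, snd q}"
          using q(5,4,2) A[OF q(1)] A[OF p(2)] True L p(2) q(1)
          by (auto simp: link_def node_eq_iff split: if_splits)
        then show ?thesis using q base by blast
      next
        case False
        then have v: "v = snd p" using ve p by auto
        obtain q l where q: "q \<in> arcs n E" "l \<le> L" "link n L q l \<in> F'" "link n L q l \<noteq> link n L p L"
          "node n L p (Suc L) \<in> link n L q l"
          using other[OF pL, of "node n L p (Suc L)"] unfolding link_def[of n L p] by blast
        have "q \<noteq> p \<and> v \<in> {fst q, snd q}"
          using q(5,4,2) A[OF q(1)] A[OF p(2)] v L p(2) q(1)
          by (auto simp: link_def node_eq_iff split: if_splits)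
        then show ?thesis using q base by blast
      qed
      then obtain q where q: "q \<in> arcs n E" "q \<noteq> p" "link n L q 0 \<in> F'" "v \<in> {fst q, snd q}" by auto
      \<comment> \<open>Arcs are oriented upwards, so different arcs come from different
        edges.\<close>
      have "{fst q, snd q} \<noteq> e"
        using q(2) A[OF q(1)] A[OF p(2)] p(1) by (auto simp: doubleton_eq_iff prod_eq_iff)
      moreover have "{fst q, snd q} \<in> F" unfolding F_def using q by blast
      ultimately show ?thesis using q(4) by (intro bexI[of _ "{fst q, snd q}"] conjI)
    qed
    ultimately have "core F" unfolding core_def by blast
    moreover have "F \<subseteq> E" using A by (auto simp: F_def)
    moreover have "\<forall>e\<in>F. e \<inter> S = {}"
    proof
      fix e assume "e \<in> F"
      then obtain p where p: "e = {fst p, snd p}" "p \<in> arcs n E" "link n L p 0 \<in> F'"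
        unfolding F_def by blast
      have "link n L p L \<in> F'" using p base[OF p(2) le_refl] by simp
      then have "link n L p 0 \<inter> ?S = {}" "link n L p L \<inter> ?S = {}" using F'(3) p by blast+
      then have "code n L (fst p) (fst p) 0 \<notin> ?S" "code n L (snd p) (snd p) 0 \<notin> ?S"
        by (auto simp: link_def node_def)
      then show "e \<inter> S = {}" using p by auto
    qed
    moreover have "\<not> (\<exists>F\<subseteq>E. core F \<and> (\<forall>e\<in>F. e \<inter> S = {}))"
      using S feedback_vertex_set_iff_core[OF G, of S] by simp
    ultimately show False by blast
  qed
  moreover have "?S \<subseteq> verts (subdivide n L E)" using SV L by (auto simp: subdivide_def intro: code_less)
  ultimately show ?thesis
    unfolding feedback_vertex_set_iff_core[OF simple_subdivide[OF L]] by blast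
qed

text \<open>A core that avoids the projection of \<open>S\<close> lifts to the union of the paths
  over its edges. This lift avoids \<open>S\<close>, since every node of a path projects to an end
  of its edge.\<close>

lemma fvs_of_subdivide:
  assumes G: "simple_graph (Graph {..<n} E)" and L: "0 < L"
    and S: "feedback_vertex_set (subdivide n L E) S"
  shows "feedback_vertex_set (Graph {..<n} E) ((\<lambda>v. v div (n * L)) ` S)"
proof -
  let ?S = "(\<lambda>v. v div (n * L)) ` S"
  note A = arcsD[of _ n E]
  have SV: "S \<subseteq> {..<n * n * L}" using S by (auto simp: feedback_vertex_set_def subdivide_def)
  have False if F: "F \<subseteq> E" "core F" "\<forall>e\<in>F. e \<inter> ?S = {}" for F
  proof -
    have edge: "\<exists>p\<in>arcs n E. e = {fst p, snd p}" if "e \<in> F" for e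
    proof -
      have "card e = 2" "e \<subseteq> {..<n}" using G F that by (auto simp: simple_graph_def)
      then obtain a b where "e = {a, b}" "a \<noteq> b" "a < n" "b < n" by (auto simp: card_2_iff)
      then have "e = {min a b, max a b}" "min a b < max a b" "max a b < n" by (auto simp: min_def max_def)
      then show ?thesis using F that by (intro bexI[of _ "(min a b, max a b)"]) (auto simp: arcs_def)
    qed
    define F' where "F' = {link n L p k | p k. p \<in> arcs n E \<and> {fst p, snd p} \<in> F \<and> k \<le> L}"
    obtain p0 where "p0 \<in> arcs n E" "{fst p0, snd p0} \<in> F"
      using F(2) edge unfolding core_def by (metis ex_in_conv)
    then have "link n L p0 0 \<in> F'" unfolding F'_def by blast
    then have "F' \<noteq> {}" by blast
    moreover have "\<exists>e'\<in>F'. e' \<noteq> e \<and> v \<in> e'" if eF: "e \<in> F'" and ve: "v \<in> e" for e v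
    proof -
      obtain p k where p: "e = link n L p k" "p \<in> arcs n E" "{fst p, snd p} \<in> F" "k \<le> L"
        using eF unfolding F'_def by blast
      have fin: ?thesis if "l \<le> L" "l \<noteq> k" "v \<in> link n L p l" for l
        using that p link_inject[OF p(2,2), of l L k] L
        unfolding F'_def by blast
      \<comment> \<open>At an original vertex the second edge of \<open>F\<close> supplies a link of
        another path; at an inner node \<open>fin\<close> takes the neighbouring link of the same
        path.\<close>
      have ends: ?thesis if w: "w \<in> {fst p, snd p}" "v = code n L w w 0" for w
      proof -
        obtain e' where e': "e' \<in> F" "e' \<noteq> {fst p, snd p}" "w \<in> e'"
          using F(2) p(3) w(1) unfolding core_def by blast
        then obtain q where q: "q \<in> arcs n E" "e' = {fst q, snd q}" using edge by blast
        then have "q \<noteq> p" using e' by auto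
        have "v \<in> link n L q 0 \<or> v \<in> link n L q L"
          using e'(3) q(2) w by (auto simp: link_def node_def)
        then obtain l where l: "l \<le> L" "v \<in> link n L q l" by blast
        have "link n L q l \<noteq> e"
          using link_inject[OF q(1) p(2) l(1) p(4) L] p(1) \<open>q \<noteq> p\<close> by simp
        moreover have "link n L q l \<in> F'" unfolding F'_def using q e'(1) l(1) by blast
        ultimately show ?thesis using l(2) by (intro bexI[of _ "link n L q l"] conjI)
      qed
      consider "v = node n L p k" "k = 0" | "v = node n L p k" "0 < k"
        | "v = node n L p (Suc k)" "k = L" | "v = node n L p (Suc k)" "k < L"
        using ve p(1,4) unfolding link_def by (metis insert_iff singletonD le_neq_implies_less neq0_conv)
      then show ?thesis
      proof cases
        case 1 then show ?thesis by (intro ends[of "fst p"]) (auto simp: node_def)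
      next
        case 2 then show ?thesis using p by (intro fin[of "k - 1"]) (auto simp: link_def)
      next
        case 3 then show ?thesis by (intro ends[of "snd p"]) (auto simp: node_def)
      next
        case 4 then show ?thesis using p by (intro fin[of "Suc k"]) (auto simp: link_def)
      qed
    qed
    ultimately have "core F'" unfolding core_def by blast
    moreover have "F' \<subseteq> edges (subdivide n L E)" by (auto simp: F'_def subdivide_def)
    moreover have "\<forall>e\<in>F'. e \<inter> S = {}"
    proof (intro ballI equals0I)
      fix e v assume "e \<in> F'" "v \<in> e \<inter> S"
      then obtain p k where p: "e = link n L p k" "p \<in> arcs n E" "{fst p, snd p} \<in> F" "k \<le> L"
        unfolding F'_def by blast
      then have "v div (n * L) \<in> {fst p, snd p}"
        using \<open>v \<in> e \<inter> S\<close> node_div[OF p(2), of k L] node_div[OF p(2), of "Suc k" L] L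
        by (auto simp: link_def)
      moreover have "v div (n * L) \<in> ?S" using \<open>v \<in> e \<inter> S\<close> by simp
      moreover have "{fst p, snd p} \<inter> ?S = {}" using F(3) p(3) by (rule bspec)
      ultimately show False by (metis disjoint_iff)
    qed
    ultimately show False using S feedback_vertex_set_iff_core[OF simple_subdivide[OF L], of n E S] by blast
  qed
  moreover have "?S \<subseteq> {..<n}"
    using SV by (auto simp: less_mult_imp_div_less mult.assoc)
  ultimately show ?thesis
    unfolding feedback_vertex_set_iff_core[OF G] graph.sel by blast
qed

section \<open>Drawing a subdivision\<close>

definition arch :: "nat \<times> nat \<Rightarrow> real \<Rightarrow> real \<Rightarrow> real" where
  "arch p a x = a * ((x - real (fst p)) * (real (snd p) - x))"

definition support :: "nat \<times> nat \<Rightarrow> real set" where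
  "support p = {real (fst p)<..<real (snd p)}"

lemma arch_ends [simp]: "arch p a (real (fst p)) = 0" "arch p a (real (snd p)) = 0"
  by (auto simp: arch_def)

lemma arch_pos: "0 < a \<Longrightarrow> x \<in> support p \<Longrightarrow> 0 < arch p a x"
  by (auto simp: arch_def support_def)

text \<open>The difference of the arches is a quadratic polynomial with leading coefficient
  \<open>b - a\<close>. Meetings are counted on the whole line, also outside the supports.\<close>

lemma finite_arch_meet:
  assumes "a \<noteq> b"
  shows "finite {x. arch p a x = arch q b x}" "card {x. arch p a x = arch q b x} \<le> 2"
proof -
  define P where "P = [:- a * real (fst p) * real (snd p) + b * real (fst q) * real (snd q),
    a * (real (fst p) + real (snd p)) - b * (real (fst q) + real (snd q)), b - a:]"
  have "{x. arch p a x = arch q b x} = {x. poly P x = 0}"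
    by (auto simp: P_def arch_def algebra_simps)
  moreover have "P \<noteq> 0" using assms by (auto simp: P_def)
  moreover have "degree P \<le> 2" by (auto simp: P_def)
  ultimately show "finite {x. arch p a x = arch q b x}" "card {x. arch p a x = arch q b x} \<le> 2"
    using poly_roots_finite[of P] card_poly_roots_bound[of P] by auto
qed

text \<open>Triple points are forbidden over the open supports only: at a common end on the axis any
  number of arches may meet.\<close>

definition generic :: "(nat \<times> nat) set \<Rightarrow> (nat \<times> nat \<Rightarrow> real) \<Rightarrow> bool" where
  "generic A c \<longleftrightarrow> (\<forall>p\<in>A. 0 < c p) \<and> inj_on c A \<and>
    (\<forall>p\<in>A. \<forall>q\<in>A. \<forall>r\<in>A. \<forall>x\<in>support p \<inter> support q \<inter> support r.
       arch p (c p) x = arch q (c q) x \<longrightarrow> arch p (c p) x = arch r (c r) x \<longrightarrow> p = q \<or> p = r \<or> q = r)"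

text \<open>The coefficients are chosen one after the other: a new parabola must only avoid the finitely
  many crossings of the previous ones, and each of them excludes a single coefficient.\<close>

lemma ex_generic:
  assumes "finite A"
  shows "\<exists>c. generic A c"
  using assms
proof induction
  case empty
  show ?case by (simp add: generic_def)
next
  case (insert e A)
  then obtain c where c: "generic A c" by blast
  define C where "C = (\<Union>p\<in>A. \<Union>q\<in>A - {p}. {x. arch p (c p) x = arch q (c q) x})"
  have "finite C"
    unfolding C_def using insert(1) c
    by (intro finite_UN_I finite_Diff finite_arch_meet) (auto simp: generic_def inj_on_def)
  \<comment> \<open>An arch is linear in its coefficient, so this quotient is the only coefficient
    that sends the new arch through the crossing above \<open>x\<close>. Where the denominator
    vanishes the quotient is 0, a harmless exclusion.\<close>
  define bad where "bad = c ` A \<union> (\<lambda>(p, x). arch p (c p) x / arch e 1 x) ` (A \<times> C)"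
  have "finite bad" unfolding bad_def using insert(1) \<open>finite C\<close> by auto
  then have "infinite ({0<..} - bad)" using infinite_Ioi[of "0 :: real"] by simp
  then obtain a where a: "0 < a" "a \<notin> bad"
    by (metis Diff_iff finite.emptyI greaterThan_iff ex_in_conv)
  define c' where "c' = c(e := a)"
  have old: "c' p = c p" if "p \<in> A" for p using that insert(2) by (auto simp: c'_def)
  have new: "c' e = a" by (simp add: c'_def)
  have avoid: False if "p \<in> A" "q \<in> A" "p \<noteq> q" "x \<in> support e" "arch e a x = arch p (c p) x"
    "arch p (c p) x = arch q (c q) x" for p q x
  proof -
    have "x \<in> C" using that by (auto simp: C_def)
    then have "arch p (c p) x / arch e 1 x \<in> bad" using that by (auto simp: bad_def)
    moreover have "arch e a x = a * arch e 1 x" by (simp add: arch_def)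
    ultimately show False using arch_pos[of 1 x e] that a by (auto simp: field_simps)
  qed
  have "generic (insert e A) c'"
    unfolding generic_def
  proof (intro conjI ballI impI)
    fix p assume "p \<in> insert e A"
    then consider "p = e" | "p \<in> A" by blast
    then show "0 < c' p"
    proof cases
      case 2
      then show ?thesis using c old[OF 2] by (simp add: generic_def)
    qed (use a new in simp)
  next
    show "inj_on c' (insert e A)"
      using c a insert(2) by (auto simp: c'_def generic_def bad_def inj_on_def)
  next
    fix p q r x
    assume m: "p \<in> insert e A" "q \<in> insert e A" "r \<in> insert e A"
      and x: "x \<in> support p \<inter> support q \<inter> support r"
      and eq: "arch p (c' p) x = arch q (c' q) x" "arch p (c' p) x = arch r (c' r) x"
    show "p = q \<or> p = r \<or> q = r"
    proof (rule ccontr)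
      assume n: "\<not> (p = q \<or> p = r \<or> q = r)"
      consider "p = e" "q \<in> A" "r \<in> A" | "q = e" "p \<in> A" "r \<in> A" | "r = e" "p \<in> A" "q \<in> A"
        | "p \<in> A" "q \<in> A" "r \<in> A" using m n by auto
      then show False
      proof cases
        case 1 then show ?thesis using avoid[of q r x] x eq n old new by auto
      next
        case 2 then show ?thesis using avoid[of p r x] x eq n old new by auto
      next
        case 3 then show ?thesis using avoid[of p q x] x eq n old new by auto
      next
        case 4 then show ?thesis using c x eq n old unfolding generic_def by metis
      qed
    qed
  qed
  then show ?case by blast
qed

section \<open>Distributing the meeting points of an arch over its links\<close>

text \<open>The outermost break points may belong to \<open>T\<close>, because arches with a common
  end meet there.\<close>

definition separates :: "(nat \<Rightarrow> real) \<Rightarrow> nat \<Rightarrow> real set \<Rightarrow> bool" where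
  "separates s L T \<longleftrightarrow> (\<forall>k\<le>L. s k < s (Suc k)) \<and> (\<forall>k. 0 < k \<longrightarrow> k \<le> L \<longrightarrow> s k \<notin> T) \<and>
    (\<forall>k\<le>L. \<forall>x\<in>T. \<forall>y\<in>T. x \<in> {s k<..<s (Suc k)} \<longrightarrow> y \<in> {s k<..<s (Suc k)} \<longrightarrow> x = y)"

lemma separates_less: "separates s L T \<Longrightarrow> k \<le> L \<Longrightarrow> s k < s (Suc k)"
  by (simp add: separates_def)

lemma separates_notin: "separates s L T \<Longrightarrow> 0 < k \<Longrightarrow> k \<le> L \<Longrightarrow> s k \<notin> T"
  by (simp add: separates_def)

lemma separates_eq:
  "separates s L T \<Longrightarrow> k \<le> L \<Longrightarrow> x \<in> T \<Longrightarrow> y \<in> T \<Longrightarrow> x \<in> {s k<..<s (Suc k)} \<Longrightarrow>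
    y \<in> {s k<..<s (Suc k)} \<Longrightarrow> x = y"
  unfolding separates_def by metis

text \<open>Induction on \<open>L\<close>: a cut just below the greatest point of \<open>T\<close>
  inside the interval leaves one point fewer on its left, to be separated with one break point
  fewer.\<close>

lemma ex_separates:
  fixes a b :: real and T :: "real set"
  assumes "finite T" "card T \<le> Suc L" "a < b"
  shows "\<exists>s. s 0 = a \<and> s (Suc L) = b \<and> separates s L T"
  using assms
proof (induction L arbitrary: T b)
  case 0
  then have "x = y" if "x \<in> T" "y \<in> T" for x y
    using that card_le_Suc0_iff_eq[of T] by auto
  with 0 show ?case
    by (intro exI[of _ "\<lambda>k. if k = 0 then a else b"]) (auto simp: separates_def)
next
  case (Suc L)
  \<comment> \<open>\<open>T\<close> may have points outside the interval, which must not determine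
    the cut.\<close>
  define T' where "T' = T \<inter> {a<..<b}"
  have T': "finite T'" "card T' \<le> card T"
    using Suc.prems by (auto simp: T'_def intro: card_mono)
  obtain c where c: "a < c" "c < b" "c \<notin> T" "card (T' \<inter> {..<c}) \<le> Suc L"
    "\<And>x y. x \<in> T' \<Longrightarrow> y \<in> T' \<Longrightarrow> c < x \<Longrightarrow> c < y \<Longrightarrow> x = y"
  proof (cases "T' = {}")
    case True
    have "infinite ({a<..<b} - T)" using Suc.prems by simp
    then obtain c where "c \<in> {a<..<b} - T" by (metis finite.emptyI ex_in_conv)
    then show ?thesis using that[of c] True by auto
  next
    case False
    define m where "m = Max T'"
    have m: "m \<in> T'" "\<And>x. x \<in> T' \<Longrightarrow> x \<le> m" using T' False by (auto simp: m_def)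
    \<comment> \<open>The second greatest point, or the left end \<open>a\<close> if there is none;
      the cut goes between \<open>l\<close> and \<open>m\<close>.\<close>
    define l where "l = Max (insert a (T' - {m}))"
    have lin: "l \<in> insert a (T' - {m})"
      unfolding l_def by (rule Max_in) (use T' in auto)
    have l: "a \<le> l" "\<And>x. x \<in> T' \<Longrightarrow> x \<noteq> m \<Longrightarrow> x \<le> l" using T' by (auto simp: l_def)
    have "l < m"
    proof (cases "l = a")
      case True then show ?thesis using m(1) by (auto simp: T'_def)
    next
      case False then show ?thesis using lin m(2)[of l] by auto
    qed
    then have "infinite ({l<..<m} - T)" using Suc.prems by simp
    then obtain c where c: "l < c" "c < m" "c \<notin> T"
      by (metis Diff_iff finite.emptyI ex_in_conv greaterThanLessThan_iff)
    have "m < b" using m(1) by (auto simp: T'_def)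
    have "card (T' \<inter> {..<c}) \<le> card (T' - {m})"
      by (rule card_mono) (use T' c in auto)
    also have "\<dots> \<le> Suc L" using m(1) T' Suc.prems(2) by simp
    finally have "card (T' \<inter> {..<c}) \<le> Suc L" .
    moreover have "x = y" if "x \<in> T'" "y \<in> T'" "c < x" "c < y" for x y
    proof -
      have "x = m" "y = m" using l(2)[of x] l(2)[of y] that c by force+
      then show ?thesis by simp
    qed
    ultimately show ?thesis using that[of c] c l(1) \<open>m < b\<close> by fastforce
  qed
  have "\<exists>\<sigma>. \<sigma> 0 = a \<and> \<sigma> (Suc L) = c \<and> separates \<sigma> L (T' \<inter> {..<c})"
    by (rule Suc.IH) (use T' c in auto)
  then obtain \<sigma> where \<sigma>: "\<sigma> 0 = a" "\<sigma> (Suc L) = c" and sep: "separates \<sigma> L (T' \<inter> {..<c})" by blast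
  note \<sigma> = \<sigma> separates_less[OF sep] separates_notin[OF sep] separates_eq[OF sep]
  have mono: "\<sigma> k < \<sigma> l" if "k < l" "l \<le> Suc L" for k l
    using that
  proof (induction l)
    case (Suc l)
    then show ?case using \<sigma>(3)[of l] by (cases "k = l") auto
  qed simp
  have lo: "a \<le> \<sigma> k" "\<sigma> k \<le> c" if "k \<le> Suc L" for k
    using mono[of 0 k] mono[of k "Suc L"] \<sigma>(1,2) that by (cases "k = 0"; cases "k = Suc L"; force)+
  define \<tau> where "\<tau> = \<sigma>(Suc (Suc L) := b)"
  have "\<tau> k \<notin> T" if "0 < k" "k \<le> Suc L" for k
  proof (cases "k = Suc L")
    case True then show ?thesis using \<sigma>(2) c by (simp add: \<tau>_def)
  next
    case False
    then have "a < \<sigma> k" "\<sigma> k < c" using mono[of 0 k] mono[of k "Suc L"] \<sigma>(1,2) that by auto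
    then show ?thesis using \<sigma>(4)[of k] that False c by (auto simp: \<tau>_def T'_def)
  qed
  moreover have "x = y" if k: "k \<le> Suc L" and xy: "x \<in> T" "y \<in> T"
    "x \<in> {\<tau> k<..<\<tau> (Suc k)}" "y \<in> {\<tau> k<..<\<tau> (Suc k)}" for k x y
  proof (cases "k = Suc L")
    case True
    then show ?thesis using xy \<sigma>(2) c by (intro c(5)) (auto simp: \<tau>_def T'_def)
  next
    case False
    then have "k \<le> L" using k by simp
    moreover have "x \<in> T' \<inter> {..<c}" "y \<in> T' \<inter> {..<c}"
      using xy lo[of k] lo[of "Suc k"] c \<open>k \<le> L\<close> by (auto simp: \<tau>_def T'_def)
    ultimately show ?thesis using xy \<sigma>(5)[of k x y] by (auto simp: \<tau>_def)
  qed
  moreover have "\<tau> k < \<tau> (Suc k)" if "k \<le> Suc L" for k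
    using that \<sigma>(2,3) c by (cases "k = Suc L") (auto simp: \<tau>_def)
  moreover have "\<tau> 0 = a" "\<tau> (Suc (Suc L)) = b" using \<sigma>(1) by (auto simp: \<tau>_def)
  ultimately show ?case unfolding separates_def by (intro exI[of _ \<tau>]) simp
qed

section \<open>The drawing in the plane\<close>

definition plane_point :: "real \<Rightarrow> real \<Rightarrow> real^2" where
  "plane_point x y = (\<chi> i. if i = 1 then x else y)"

lemma plane_point_eq_iff [simp]: "plane_point x y = plane_point x' y' \<longleftrightarrow> x = x' \<and> y = y'"
  by (auto simp: plane_point_def vec_eq_iff forall_2)

text \<open>The first coordinate alone makes the parametrisation injective, so the graph of a
  continuous function is an arc.\<close>

lemma graph_arc:
  assumes "a < b" "continuous_on {a..b} h"
  defines "g \<equiv> (\<lambda>x. plane_point x (h x)) \<circ> linepath a b"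
  shows "arc g" "path_image g = (\<lambda>x. plane_point x (h x)) ` {a..b}"
    "pathstart g = plane_point a (h a)" "pathfinish g = plane_point b (h b)"
proof -
  have im: "closed_segment a b = {a..b}"
    using assms(1) by (simp add: closed_segment_eq_real_ivl)
  have "continuous_on {a..b} (\<lambda>x. plane_point x (h x))"
    unfolding plane_point_def
  proof (rule continuous_on_vec_lambda)
    fix i :: 2
    show "continuous_on {a..b} (\<lambda>x. if i = 1 then x else h x)"
      using assms(2) by (cases "i = 1") (auto intro: continuous_intros)
  qed
  then have "path g" unfolding g_def by (intro path_continuous_image) (auto simp: im)
  moreover have "inj_on g {0..1}"
    using arc_linepath[of a b] assms(1) by (auto simp: g_def arc_def inj_on_def)
  ultimately show "arc g" by (simp add: arc_def)
  show "path_image g = (\<lambda>x. plane_point x (h x)) ` {a..b}"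
    by (simp add: g_def path_image_compose im)
qed (simp_all add: g_def pathstart_compose pathfinish_compose)


text \<open>\<open>\<sigma> p k\<close> is the abscissa of node \<open>k\<close> on the arch
  \<open>p\<close>. The assumptions on \<open>\<sigma>\<close> spell out \<open>separates\<close>
  for the abscissas where \<open>p\<close> meets the other arches.\<close>

locale arch_drawing =
  fixes n L :: nat and E :: "nat set set" and c :: "nat \<times> nat \<Rightarrow> real" and \<sigma> :: "nat \<times> nat \<Rightarrow> nat \<Rightarrow> real"
  assumes L: "0 < L"
    and c: "generic (arcs n E) c"
    and \<sigma>_0: "p \<in> arcs n E \<Longrightarrow> \<sigma> p 0 = real (fst p)"
    and \<sigma>_end: "p \<in> arcs n E \<Longrightarrow> \<sigma> p (Suc L) = real (snd p)"
    and \<sigma>_step: "p \<in> arcs n E \<Longrightarrow> k \<le> L \<Longrightarrow> \<sigma> p k < \<sigma> p (Suc k)"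
    and \<sigma>_avoids: "p \<in> arcs n E \<Longrightarrow> q \<in> arcs n E \<Longrightarrow> p \<noteq> q \<Longrightarrow> 0 < k \<Longrightarrow> k \<le> L \<Longrightarrow>
      arch p (c p) (\<sigma> p k) \<noteq> arch q (c q) (\<sigma> p k)"
    and \<sigma>_separates: "p \<in> arcs n E \<Longrightarrow> q \<in> arcs n E - {p} \<Longrightarrow> q' \<in> arcs n E - {p} \<Longrightarrow> k \<le> L \<Longrightarrow>
      arch p (c p) x = arch q (c q) x \<Longrightarrow> arch p (c p) y = arch q' (c q') y \<Longrightarrow>
      x \<in> {\<sigma> p k<..<\<sigma> p (Suc k)} \<Longrightarrow> y \<in> {\<sigma> p k<..<\<sigma> p (Suc k)} \<Longrightarrow> x = y"
begin

abbreviation A :: "(nat \<times> nat) set" where "A \<equiv> arcs n E"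
abbreviation h :: "nat \<times> nat \<Rightarrow> real \<Rightarrow> real" where "h p \<equiv> arch p (c p)"
abbreviation pt :: "nat \<times> nat \<Rightarrow> real \<Rightarrow> real^2" where "pt p x \<equiv> plane_point x (h p x)"

lemma \<sigma>_less: "p \<in> A \<Longrightarrow> k < l \<Longrightarrow> l \<le> Suc L \<Longrightarrow> \<sigma> p k < \<sigma> p l"
proof (induction l)
  case (Suc l)
  then show ?case using \<sigma>_step[of p l] by (cases "k = l") auto
qed simp

lemma \<sigma>_le: "p \<in> A \<Longrightarrow> k \<le> l \<Longrightarrow> l \<le> Suc L \<Longrightarrow> \<sigma> p k \<le> \<sigma> p l"
  using \<sigma>_less[of p k l] by (cases "k = l") auto

lemma \<sigma>_less_iff: "p \<in> A \<Longrightarrow> k \<le> Suc L \<Longrightarrow> l \<le> Suc L \<Longrightarrow> \<sigma> p k < \<sigma> p l \<longleftrightarrow> k < l"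
  using \<sigma>_less[of p k l] \<sigma>_le[of p l k] by fastforce

lemma \<sigma>_le_iff: "p \<in> A \<Longrightarrow> k \<le> Suc L \<Longrightarrow> l \<le> Suc L \<Longrightarrow> \<sigma> p k \<le> \<sigma> p l \<longleftrightarrow> k \<le> l"
  using \<sigma>_less_iff[of p l k] by fastforce

lemma gap_unique:
  assumes "p \<in> A" "k \<le> L" "l \<le> L" "\<sigma> p k < x" "x < \<sigma> p (Suc k)" "\<sigma> p l < x" "x < \<sigma> p (Suc l)"
  shows "k = l"
proof -
  have "\<sigma> p k < \<sigma> p (Suc l)" "\<sigma> p l < \<sigma> p (Suc k)" using assms by linarith+
  then show ?thesis using assms(1-3) \<sigma>_less_iff[of p k "Suc l"] \<sigma>_less_iff[of p l "Suc k"] by auto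
qed

lemma gap_support:
  assumes "p \<in> A" "k \<le> L" "\<sigma> p k < x" "x < \<sigma> p (Suc k)"
  shows "x \<in> support p"
  using assms \<sigma>_le[of p 0 k] \<sigma>_le[of p "Suc k" "Suc L"] \<sigma>_0[of p] \<sigma>_end[of p]
  by (auto simp: support_def)

lemma segment_range:
  assumes "p \<in> A" "k \<le> L" "\<sigma> p k \<le> x" "x \<le> \<sigma> p (Suc k)"
  shows "real (fst p) \<le> x" "x \<le> real (snd p)"
  using assms \<sigma>_le[of p 0 k] \<sigma>_le[of p "Suc k" "Suc L"] \<sigma>_0[of p] \<sigma>_end[of p] by auto

lemma c_pos: "p \<in> A \<Longrightarrow> 0 < c p"
  using c by (simp add: generic_def)

lemma h_nonneg: "p \<in> A \<Longrightarrow> real (fst p) \<le> x \<Longrightarrow> x \<le> real (snd p) \<Longrightarrow> 0 \<le> h p x"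
  using c_pos[of p] by (auto simp: arch_def)

lemma h_zero:
  assumes "p \<in> A" "h p x = 0"
  shows "x = real (fst p) \<or> x = real (snd p)"
  using assms c_pos[of p] by (auto simp: arch_def)

lemma \<sigma>_meet:
  assumes "p \<in> A" "q \<in> A" "p \<noteq> q" "k \<le> Suc L" "h p (\<sigma> p k) = h q (\<sigma> p k)"
  shows "k = 0 \<or> k = Suc L"
  using \<sigma>_avoids[of p q k] assms by (metis le_SucE neq0_conv)

lemma \<sigma>_ends: "p \<in> A \<Longrightarrow> k = 0 \<or> k = Suc L \<Longrightarrow> \<sigma> p k = real (if k = 0 then fst p else snd p)"
  using \<sigma>_0[of p] \<sigma>_end[of p] by auto

lemma h_ends: "p \<in> A \<Longrightarrow> k = 0 \<or> k = Suc L \<Longrightarrow> h p (\<sigma> p k) = 0"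
  using \<sigma>_0[of p] \<sigma>_end[of p] by auto

text \<open>An original vertex is a node of several paths. The implication to the right makes its
  position independent of the path chosen in \<open>pos\<close>, the converse gives
  injectivity.\<close>

lemma node_eq_iff_pt:
  assumes "p \<in> A" "q \<in> A" "k \<le> Suc L" "l \<le> Suc L"
  shows "node n L p k = node n L q l \<longleftrightarrow> pt p (\<sigma> p k) = pt q (\<sigma> q l)"
proof
  assume "node n L p k = node n L q l"
  then have "(k = 0 \<or> k = Suc L) \<and> (l = 0 \<or> l = Suc L) \<and>
      (if k = 0 then fst p else snd p) = (if l = 0 then fst q else snd q) \<or> k = l \<and> p = q"
    using node_eq_iff[OF assms L] by (auto split: if_splits)
  then show "pt p (\<sigma> p k) = pt q (\<sigma> q l)"
  proof
    assume e: "(k = 0 \<or> k = Suc L) \<and> (l = 0 \<or> l = Suc L) \<and>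
      (if k = 0 then fst p else snd p) = (if l = 0 then fst q else snd q)"
    then show ?thesis
      using \<sigma>_ends[of p k] \<sigma>_ends[of q l] h_ends[of p k] h_ends[of q l] assms(1,2) by simp
  qed simp
next
  assume eq: "pt p (\<sigma> p k) = pt q (\<sigma> q l)"
  show "node n L p k = node n L q l"
  proof (cases "p = q")
    case True
    then show ?thesis using eq assms \<sigma>_less_iff[of p k l] \<sigma>_less_iff[of p l k]
      by (metis less_irrefl linorder_neqE_nat plane_point_eq_iff)
  next
    case False
    then have kl: "k = 0 \<or> k = Suc L" "l = 0 \<or> l = Suc L"
      using \<sigma>_meet[of p q k] \<sigma>_meet[of q p l] eq assms by auto
    moreover have "(if k = 0 then fst p else snd p) = (if l = 0 then fst q else snd q)"
      using \<sigma>_ends[of p k] \<sigma>_ends[of q l] kl eq assms(1,2) by simp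
    ultimately show ?thesis using node_eq_iff[OF assms L] by auto
  qed
qed

definition on_path :: "nat \<Rightarrow> (nat \<times> nat) \<times> nat \<Rightarrow> bool" where
  "on_path v = (\<lambda>(p, k). p \<in> A \<and> k \<le> Suc L \<and> v = node n L p k)"

text \<open>The isolated vertices are moved out of the way, below the axis.\<close>

definition pos :: "nat \<Rightarrow> real^2" where
  "pos v = (if \<exists>x. on_path v x then (let (p, k) = (SOME x. on_path v x) in pt p (\<sigma> p k))
     else plane_point (real v) (- 1))"

lemma pos_node:
  assumes "p \<in> A" "k \<le> Suc L"
  shows "pos (node n L p k) = pt p (\<sigma> p k)"
proof -
  let ?v = "node n L p k"
  have ex: "on_path ?v (p, k)" using assms by (simp add: on_path_def)
  obtain q l where ql: "(SOME x. on_path ?v x) = (q, l)" by fastforce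
  then have "on_path ?v (q, l)" using someI[of "on_path ?v", OF ex] by simp
  then have q: "q \<in> A" "l \<le> Suc L" "?v = node n L q l" by (simp_all add: on_path_def)
  have "pt q (\<sigma> q l) = pt p (\<sigma> p k)"
    using node_eq_iff_pt[THEN iffD1, OF assms(1) q(1) assms(2) q(2,3)] by (rule sym)
  moreover have "\<exists>x. on_path ?v x" using ex by (rule exI)
  ultimately show ?thesis by (simp only: pos_def ql if_True Let_def prod.case)
qed

lemma pos_cases:
  obtains p k where "p \<in> A" "k \<le> Suc L" "v = node n L p k" "pos v = pt p (\<sigma> p k)"
  | "pos v = plane_point (real v) (- 1)"
proof (cases "\<exists>x. on_path v x")
  case True
  then obtain p k where "p \<in> A" "k \<le> Suc L" "v = node n L p k" by (auto simp: on_path_def)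
  then show ?thesis using that(1) pos_node by blast
next
  case False
  then show ?thesis using that(2) by (simp add: pos_def)
qed

lemma h_\<sigma>_nonneg: "p \<in> A \<Longrightarrow> k \<le> Suc L \<Longrightarrow> 0 \<le> h p (\<sigma> p k)"
  using h_nonneg[of p "\<sigma> p k"] \<sigma>_le[of p 0 k] \<sigma>_le[of p k "Suc L"] \<sigma>_0[of p] \<sigma>_end[of p] by simp

text \<open>Nodes of paths have height at least 0 and isolated vertices height -1, so the two kinds
  cannot collide.\<close>

lemma inj_pos: "inj pos"
proof (rule injI)
  fix v w assume eq: "pos v = pos w"
  show "v = w"
  proof (cases v rule: pos_cases)
    case v: (1 p k)
    show ?thesis
    proof (cases w rule: pos_cases)
      case (1 q l)
      then show ?thesis using v eq node_eq_iff_pt[of p q k l] by metis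
    next
      case 2
      then have "h p (\<sigma> p k) = - 1" using v(4) eq by simp
      then show ?thesis using h_\<sigma>_nonneg[OF v(1,2)] by simp
    qed
  next
    case v: 2
    show ?thesis
    proof (cases w rule: pos_cases)
      case (1 q l)
      then have "pt q (\<sigma> q l) = plane_point (real v) (- 1)" using v eq by metis
      then have "h q (\<sigma> q l) = - 1" by (rule plane_point_eq_iff[THEN iffD1, THEN conjunct2])
      then show ?thesis using h_\<sigma>_nonneg[OF 1(1,2)] by simp
    next
      case 2
      then show ?thesis using v eq by simp
    qed
  qed
qed

text \<open>Edges are bare sets, so the path and the position of a link have to be recovered by
  choice.\<close>

definition curve :: "nat set \<Rightarrow> real \<Rightarrow> real^2" where
  "curve e = (SOME g. \<exists>p\<in>A. \<exists>k\<le>L. e = link n L p k \<and> g = pt p \<circ> linepath (\<sigma> p k) (\<sigma> p (Suc k)))"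

lemma curve_props:
  assumes "e \<in> edges (subdivide n L E)"
  obtains p k where "p \<in> A" "k \<le> L" "e = link n L p k"
    "arc (curve e)" "path_image (curve e) = pt p ` {\<sigma> p k..\<sigma> p (Suc k)}"
    "pathstart (curve e) = pt p (\<sigma> p k)" "pathfinish (curve e) = pt p (\<sigma> p (Suc k))"
    "pos ` e = {pt p (\<sigma> p k), pt p (\<sigma> p (Suc k))}"
    "edge_interior pos curve e = pt p ` {\<sigma> p k<..<\<sigma> p (Suc k)}"
proof -
  have "\<exists>g. \<exists>p\<in>A. \<exists>k\<le>L. e = link n L p k \<and> g = pt p \<circ> linepath (\<sigma> p k) (\<sigma> p (Suc k))"
    using assms unfolding subdivide_def graph.sel by blast
  from someI_ex[OF this] obtain p k where p: "p \<in> A" "k \<le> L" "e = link n L p k"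
    and g: "curve e = pt p \<circ> linepath (\<sigma> p k) (\<sigma> p (Suc k))"
    unfolding curve_def by blast
  have "continuous_on {\<sigma> p k..\<sigma> p (Suc k)} (h p)"
    unfolding arch_def by (intro continuous_intros)
  note arc = graph_arc[OF \<sigma>_step[OF p(1,2)] this, folded g]
  have e: "pos ` e = {pt p (\<sigma> p k), pt p (\<sigma> p (Suc k))}"
    using p pos_node[of p k] pos_node[of p "Suc k"] by (simp add: link_def)
  have "edge_interior pos curve e = pt p ` {\<sigma> p k<..<\<sigma> p (Suc k)}"
    unfolding edge_interior_def e arc(2) by (auto simp: image_iff)
  with p arc e show ?thesis by (rule that)
qed

text \<open>The point is that no vertex lies inside a link. Nodes of the same arch are excluded by
  monotonicity of \<open>\<sigma>\<close>, isolated vertices by their height. A node of another arch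
  could only be an end of it, hence on the axis, where \<open>p\<close> has nothing but its own
  ends.\<close>

lemma drawing: "drawing (subdivide n L E) pos curve"
  unfolding drawing_def
proof (intro conjI ballI)
  show "inj_on pos (verts (subdivide n L E))" using inj_pos by (rule inj_on_subset) simp
next
  fix e assume e: "e \<in> edges (subdivide n L E)"
  show "arc (curve e)" using e by (rule curve_props)
  show "{pathstart (curve e), pathfinish (curve e)} = pos ` e" using e by (rule curve_props) simp
  from e obtain p k where p: "p \<in> A" "k \<le> L" "path_image (curve e) = pt p ` {\<sigma> p k..\<sigma> p (Suc k)}"
    "pos ` e = {pt p (\<sigma> p k), pt p (\<sigma> p (Suc k))}" by (rule curve_props)
  have "e \<subseteq> verts (subdivide n L E)" using e simple_subdivide[OF L] by (auto simp: simple_graph_def)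
  moreover have "pos ` e \<subseteq> path_image (curve e)" using p \<sigma>_step[of p k] by auto
  moreover have "pos v \<in> pos ` e" if v: "pos v \<in> path_image (curve e)" for v
  proof -
    obtain x where "x \<in> {\<sigma> p k..\<sigma> p (Suc k)}" "pos v = pt p x" using v unfolding p(3) by blast
    then have x: "pos v = pt p x" "\<sigma> p k \<le> x" "x \<le> \<sigma> p (Suc k)" by simp_all
    note r = segment_range[OF p(1,2) x(2,3)]
    have "x = \<sigma> p k \<or> x = \<sigma> p (Suc k)"
    proof (cases v rule: pos_cases)
      case (1 q l)
      then have xl: "x = \<sigma> q l" "h p x = h q x" using x by auto
      show ?thesis
      proof (cases "q = p")
        case True
        then have "k \<le> l" "l \<le> Suc k"
          using x xl \<sigma>_le_iff[of p k l] \<sigma>_le_iff[of p l "Suc k"] 1 p by auto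
        then show ?thesis using xl True by (metis le_SucE le_antisym)
      next
        case False
        then have "l = 0 \<or> l = Suc L" using \<sigma>_meet[of q p l] 1 p xl by auto
        then have "h p x = 0" using h_ends[of q l] 1 xl by auto
        then have "x = \<sigma> p 0 \<or> x = \<sigma> p (Suc L)" using h_zero[of p x] p \<sigma>_0 \<sigma>_end by auto
        then show ?thesis
        proof
          assume "x = \<sigma> p 0"
          then show ?thesis using x(2) \<sigma>_le_iff[of p k 0] p by auto
        next
          assume "x = \<sigma> p (Suc L)"
          then show ?thesis using x(3) \<sigma>_le_iff[of p "Suc L" "Suc k"] p by auto
        qed
      qed
    next
      case 2
      then show ?thesis using x(1) h_nonneg[OF p(1) r] by simp
    qed
    then show ?thesis using p(4) x(1) by auto
  qed
  ultimately show "path_image (curve e) \<inter> pos ` verts (subdivide n L E) = pos ` e" by blast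
qed

text \<open>Separation leaves one abscissa, genericity one other arch through that point, and
  \<open>gap_unique\<close> one link of this arch.\<close>

lemma crossings_unique:
  assumes e: "e \<in> edges (subdivide n L E)"
    and f: "(f, z) \<in> crossings (subdivide n L E) pos curve e"
    and g: "(g, w) \<in> crossings (subdivide n L E) pos curve e"
  shows "(f, z) = (g, w)"
proof -
  obtain p k where p: "p \<in> A" "k \<le> L" "e = link n L p k"
    "edge_interior pos curve e = pt p ` {\<sigma> p k<..<\<sigma> p (Suc k)}"
    using e by (rule curve_props)
  have crossing: "\<exists>q l x. q \<in> A \<and> q \<noteq> p \<and> l \<le> L \<and> f = link n L q l \<and> z = pt p x \<and> h p x = h q x \<and>
      x \<in> {\<sigma> p k<..<\<sigma> p (Suc k)} \<and> x \<in> {\<sigma> q l<..<\<sigma> q (Suc l)}"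
    if "(f, z) \<in> crossings (subdivide n L E) pos curve e" for f z
  proof -
    have fE: "f \<in> edges (subdivide n L E)" and "f \<noteq> e"
      and z: "z \<in> edge_interior pos curve e" "z \<in> edge_interior pos curve f"
      using that by (auto simp: crossings_def)
    from fE obtain q l where q: "q \<in> A" "l \<le> L" "f = link n L q l"
      "edge_interior pos curve f = pt q ` {\<sigma> q l<..<\<sigma> q (Suc l)}" by (rule curve_props)
    then obtain x where x: "z = pt p x" "h p x = h q x" "x \<in> {\<sigma> p k<..<\<sigma> p (Suc k)}"
      "x \<in> {\<sigma> q l<..<\<sigma> q (Suc l)}" using z p by auto
    \<comment> \<open>Different links of one path lie over disjoint open intervals.\<close>
    have "q \<noteq> p" using gap_unique[of p k l x] x p q \<open>f \<noteq> e\<close> by auto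
    with q x show ?thesis by blast
  qed
  obtain q l x where q: "q \<in> A" "q \<noteq> p" "l \<le> L" "f = link n L q l" "z = pt p x" "h p x = h q x"
    "x \<in> {\<sigma> p k<..<\<sigma> p (Suc k)}" "x \<in> {\<sigma> q l<..<\<sigma> q (Suc l)}" using crossing[OF f] by blast
  obtain r m y where r: "r \<in> A" "r \<noteq> p" "m \<le> L" "g = link n L r m" "w = pt p y" "h p y = h r y"
    "y \<in> {\<sigma> p k<..<\<sigma> p (Suc k)}" "y \<in> {\<sigma> r m<..<\<sigma> r (Suc m)}" using crossing[OF g] by blast
  have "x = y" using \<sigma>_separates[of p q r k x y] p q r by auto
  have "x \<in> support p" "x \<in> support q" "x \<in> support r"
    using gap_support[of p k x] gap_support[of q l x] gap_support[of r m x] p q r \<open>x = y\<close> by auto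
  then have "q = r" using c p(1) q(1,2,6) r(1,2,6) \<open>x = y\<close> unfolding generic_def by (metis IntI)
  then have "l = m" using gap_unique[of q l m x] q r \<open>x = y\<close> by auto
  with \<open>q = r\<close> \<open>x = y\<close> q r show ?thesis by simp
qed

lemma one_planar: "one_planar (subdivide n L E)"
  unfolding one_planar_def
proof (intro exI conjI ballI)
  show "drawing (subdivide n L E) pos curve" by (rule drawing)
next
  fix e assume e: "e \<in> edges (subdivide n L E)"
  let ?X = "crossings (subdivide n L E) pos curve e"
  obtain x where x: "?X \<subseteq> {x}"
  proof (cases "?X = {}")
    case False
    then obtain f z where "(f, z) \<in> ?X" by auto
    then have "?X \<subseteq> {(f, z)}" using crossings_unique[OF e] by auto
    then show ?thesis by (rule that)
  qed (use that in blast)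
  then show "finite ?X" by (rule finite_subset) simp
  from x show "card ?X \<le> 1" using card_mono[OF _ x] by simp
qed

end

text \<open>Two meetings with each other arch give at most \<open>2 * card (arcs n E)\<close>
  abscissas, and there are \<open>Suc L\<close> links to take one each.\<close>

lemma one_planar_subdivide:
  assumes L: "0 < L" and card: "2 * card (arcs n E) \<le> Suc L"
  shows "one_planar (subdivide n L E)"
proof -
  let ?A = "arcs n E"
  have fin: "finite ?A" by (rule finite_subset[of _ "{..<n} \<times> {..<n}"]) (auto simp: arcs_def)
  obtain c where c: "generic ?A c" using ex_generic[OF fin] ..
  have ne: "c p \<noteq> c q" if "p \<in> ?A" "q \<in> ?A - {p}" for p q
    using c that by (auto simp: generic_def inj_on_def)
  define T where "T p = (\<Union>q\<in>?A - {p}. {x. arch p (c p) x = arch q (c q) x})" for p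
  have "\<exists>s. s 0 = real (fst p) \<and> s (Suc L) = real (snd p) \<and> separates s L (T p)"
    if p: "p \<in> ?A" for p
  proof (rule ex_separates)
    show "finite (T p)" unfolding T_def using fin ne[OF p] by (intro finite_UN_I finite_arch_meet) auto
    have "card (T p) \<le> (\<Sum>q\<in>?A - {p}. card {x. arch p (c p) x = arch q (c q) x})"
      unfolding T_def using fin by (intro card_UN_le) auto
    also have "\<dots> \<le> (\<Sum>q\<in>?A - {p}. 2)"
      using finite_arch_meet(2) ne[OF p] by (intro sum_mono) blast
    also have "\<dots> \<le> 2 * card ?A" using fin by (simp add: card_Diff1_le)
    finally show "card (T p) \<le> Suc L" using card by linarith
    show "real (fst p) < real (snd p)" using arcsD[OF p] by simp
  qed
  then obtain \<sigma> where \<sigma>: "\<And>p. p \<in> ?A \<Longrightarrow> \<sigma> p 0 = real (fst p)"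
    "\<And>p. p \<in> ?A \<Longrightarrow> \<sigma> p (Suc L) = real (snd p)" "\<And>p. p \<in> ?A \<Longrightarrow> separates (\<sigma> p) L (T p)"
    by metis
  have "arch_drawing n L E c \<sigma>"
  proof
    fix p q k assume "p \<in> ?A" "q \<in> ?A" "p \<noteq> q" "0 < k" "k \<le> L"
    then have "\<sigma> p k \<notin> T p" using \<sigma>(3) separates_notin by blast
    then show "arch p (c p) (\<sigma> p k) \<noteq> arch q (c q) (\<sigma> p k)"
      using \<open>q \<in> ?A\<close> \<open>p \<noteq> q\<close> by (auto simp: T_def)
  next
    fix p q q' k x y
    assume p: "p \<in> ?A" "q \<in> ?A - {p}" "q' \<in> ?A - {p}" "k \<le> L" "arch p (c p) x = arch q (c q) x"
      "arch p (c p) y = arch q' (c q') y"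
      and x: "x \<in> {\<sigma> p k<..<\<sigma> p (Suc k)}" "y \<in> {\<sigma> p k<..<\<sigma> p (Suc k)}"
    then have "x \<in> T p" "y \<in> T p" by (auto simp: T_def)
    then show "x = y" using separates_eq[OF \<sigma>(3)[OF p(1)] p(4)] x by blast
  next
    fix p k assume "p \<in> ?A" "k \<le> L"
    then show "\<sigma> p k < \<sigma> p (Suc k)" using \<sigma>(3) separates_less by blast
  qed (use L c \<sigma>(1,2) in simp_all)
  then interpret arch_drawing n L E c \<sigma> .
  show ?thesis by (rule one_planar)
qed

section \<open>Programs\<close>

text \<open>Assertions are lists of register contents, so that side conditions about registers
  become computations with finite sets of numerals.\<close>

definition agree :: "(nat \<times> nat) list \<Rightarrow> state \<Rightarrow> bool" where
  "agree \<rho> s \<longleftrightarrow> (\<forall>(x, v)\<in>set \<rho>. regs s x = v)"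

lemma agree_simps [simp]:
  "agree [] s" "agree ((x, v) # \<rho>) s \<longleftrightarrow> regs s x = v \<and> agree \<rho> s"
  "agree (\<rho> @ \<rho>') s \<longleftrightarrow> agree \<rho> s \<and> agree \<rho>' s"
  by (auto simp: agree_def ball_Un)

lemma agreeD: "agree \<rho> s \<Longrightarrow> (x, v) \<in> set \<rho> \<Longrightarrow> regs s x = v"
  by (auto simp: agree_def)

lemma agree_frame:
  assumes "agree \<rho> s" "\<forall>x. x \<notin> W \<longrightarrow> regs s' x = regs s x" "W \<inter> fst ` set \<rho> = {}"
  shows "agree \<rho> s'"
  using assms by (fastforce simp: agree_def)

text \<open>A total-correctness Hoare triple with cost: \<open>W\<close> is the set of registers
  that may change, \<open>bs\<close> the output appended, \<open>T\<close> the time bound. The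
  memory stays \<open>M\<close> because the reduction only reads its input.\<close>

definition triple ::
    "(nat \<Rightarrow> nat) \<Rightarrow> (nat \<times> nat) list \<Rightarrow> com \<Rightarrow> nat set \<Rightarrow> (nat \<times> nat) list \<Rightarrow> bool list \<Rightarrow> nat \<Rightarrow> bool"
  where "triple M \<rho> c W \<rho>' bs T \<longleftrightarrow>
    (\<forall>s. mem s = M \<longrightarrow> agree \<rho> s \<longrightarrow>
      (\<exists>t s'. exec c s t s' \<and> t \<le> T \<and> mem s' = M \<and> (\<forall>x. x \<notin> W \<longrightarrow> regs s' x = regs s x) \<and>
         agree \<rho>' s' \<and> outp s' = outp s @ bs))"

lemma triple_Const: "triple M \<rho> (Const r v) {r} [(r, v)] [] 1"
  unfolding triple_def by (fastforce intro: exec.Const)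

lemma triple_Add:
  assumes "(a, x) \<in> set \<rho>" "(b, y) \<in> set \<rho>"
  shows "triple M \<rho> (Add r a b) {r} [(r, x + y)] [] 1"
  unfolding triple_def by (intro allI impI exI conjI, rule exec.Add) (auto dest: assms[THEN agreeD[rotated]])

lemma triple_Load:
  assumes "(a, x) \<in> set \<rho>"
  shows "triple M \<rho> (Load r a) {r} [(r, M x)] [] 1"
  unfolding triple_def by (intro allI impI exI conjI, rule exec.Load) (auto dest: assms[THEN agreeD[rotated]])

lemma triple_Emit:
  assumes "(a, x) \<in> set \<rho>"
  shows "triple M \<rho> (Emit a) {} [] [x \<noteq> 0] 1"
  unfolding triple_def by (intro allI impI exI conjI, rule exec.Emit) (auto dest: assms[THEN agreeD[rotated]])

text \<open>The frame rule is built in: facts about registers outside \<open>W\<close> survive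
  \<open>c\<close> and are available to \<open>d\<close>.\<close>

lemma triple_Seq:
  assumes c: "triple M \<rho> c W \<rho>' bs T" and d: "triple M (\<rho>' @ \<rho>) d W' \<rho>'' bs' T'"
    and W: "W \<inter> fst ` set \<rho> = {}"
  shows "triple M \<rho> (Seq c d) (W \<union> W') \<rho>'' (bs @ bs') (T + T')"
  unfolding triple_def
proof (intro allI impI)
  fix s assume s: "mem s = M" "agree \<rho> s"
  obtain t s' where 1: "exec c s t s'" "t \<le> T" "mem s' = M" "\<forall>x. x \<notin> W \<longrightarrow> regs s' x = regs s x"
    "agree \<rho>' s'" "outp s' = outp s @ bs"
    using c s unfolding triple_def by blast
  have "agree (\<rho>' @ \<rho>) s'" using 1 s W agree_frame by simp
  then obtain u s'' where 2: "exec d s' u s''" "u \<le> T'" "mem s'' = M"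
    "\<forall>x. x \<notin> W' \<longrightarrow> regs s'' x = regs s' x" "agree \<rho>'' s''" "outp s'' = outp s' @ bs'"
    using d 1 unfolding triple_def by blast
  show "\<exists>t s'. exec (Seq c d) s t s' \<and> t \<le> T + T' \<and> mem s' = M \<and>
      (\<forall>x. x \<notin> W \<union> W' \<longrightarrow> regs s' x = regs s x) \<and> agree \<rho>'' s' \<and> outp s' = outp s @ bs @ bs'"
    using 1 2 by (intro exI[of _ "t + u"] exI[of _ s'']) (auto intro: exec.Seq)
qed

lemma triple_weaken:
  assumes "triple M \<rho> c W \<rho>1 bs T" "W \<subseteq> W'" "T \<le> T'" "set \<rho> \<subseteq> set \<rho>'" "set \<rho>2 \<subseteq> set \<rho>1"
  shows "triple M \<rho>' c W' \<rho>2 bs T'"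
  unfolding triple_def
proof (intro allI impI)
  fix s assume s: "mem s = M" "agree \<rho>' s"
  then have "agree \<rho> s" using assms(4) by (auto simp: agree_def)
  then obtain t s' where 1: "exec c s t s'" "t \<le> T" "mem s' = M" "\<forall>x. x \<notin> W \<longrightarrow> regs s' x = regs s x"
    "agree \<rho>1 s'" "outp s' = outp s @ bs"
    using assms(1) s unfolding triple_def by blast
  moreover have "agree \<rho>2 s'" using 1 assms(5) by (auto simp: agree_def)
  ultimately show "\<exists>t s'. exec c s t s' \<and> t \<le> T' \<and> mem s' = M \<and>
      (\<forall>x. x \<notin> W' \<longrightarrow> regs s' x = regs s x) \<and> agree \<rho>2 s' \<and> outp s' = outp s @ bs"
    using assms(2,3) by (intro exI[of _ t] exI[of _ s']) auto
qed

lemma exec_While_invariant: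
  assumes step: "\<And>k s. k < B \<Longrightarrow> I k s \<Longrightarrow> regs s f \<noteq> 0 \<and> (\<exists>t s'. exec c s t s' \<and> t \<le> T \<and> I (Suc k) s')"
    and stop: "\<And>s. I B s \<Longrightarrow> regs s f = 0"
    and "I 0 s"
  shows "\<exists>t s'. exec (While f c) s t s' \<and> t \<le> B * (T + 1) + 1 \<and> I B s'"
proof -
  \<comment> \<open>Generalised to an arbitrary starting round, for induction on the number of
    remaining rounds.\<close>
  have "\<exists>t s'. exec (While f c) s t s' \<and> t \<le> m * (T + 1) + 1 \<and> I B s'"
    if "k + m = B" "I k s" for k m s
    using that
  proof (induction m arbitrary: k s)
    case 0
    then have "exec (While f c) s 1 s" using stop by (intro exec.WhileFalse) simp
    then show ?case using 0 by (intro exI[of _ 1] exI[of _ s]) simp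
  next
    case (Suc m)
    then obtain t s' where 1: "regs s f \<noteq> 0" "exec c s t s'" "t \<le> T" "I (Suc k) s'"
      using step[of k s] by auto
    then obtain u s'' where "exec (While f c) s' u s''" "u \<le> m * (T + 1) + 1" "I B s''"
      using Suc.IH[of "Suc k" s'] Suc.prems by auto
    moreover have "exec (While f c) s (Suc (t + u)) s''"
      by (rule exec.WhileTrue) fact+
    moreover have "Suc (t + u) \<le> Suc m * (T + 1) + 1"
      using \<open>t \<le> T\<close> \<open>u \<le> m * (T + 1) + 1\<close> by simp
    ultimately show ?case by blast
  qed
  from this[of 0 B s] assms(3) show ?thesis by simp
qed

text \<open>Register 1 is assumed to hold the constant 1.\<close>

definition For :: "nat \<Rightarrow> nat \<Rightarrow> nat \<Rightarrow> com \<Rightarrow> com" where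
  "For r f b c = Seq (Const r 0) (Seq (Sub f b r) (While f (Seq c (Seq (Add r r 1) (Sub f b r)))))"

text \<open>\<open>\<rho>I k\<close> describes what is carried from round to round, such as a
  running address. A round costs \<open>T + 3\<close> for body, increment, new flag and test; the
  final 3 pays for two initialisations and the last test. Bounding \<open>B\<close> by
  \<open>L\<close> makes the cost depend on the input length alone.\<close>

lemma triple_For:
  assumes body: "\<And>k. k < B \<Longrightarrow> triple M ((r, k) # \<rho>I k @ \<rho>) c W (\<rho>I (Suc k)) (g k) T"
    and one: "(1, 1) \<in> set \<rho>" and b: "(b, B) \<in> set \<rho>"
    and W: "W \<inter> fst ` set \<rho> = {}" "r \<notin> W" "f \<notin> W" "r \<noteq> f" "r \<notin> fst ` set \<rho>" "f \<notin> fst ` set \<rho>"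
    and I: "\<And>k. fst ` set (\<rho>I k) \<subseteq> W"
    and L: "B \<le> L"
  shows "triple M (\<rho>I 0 @ \<rho>) (For r f b c) (W \<union> {r, f}) (\<rho>I B) (concat (map g [0..<B])) (L * (T + 3) + 3)"
  unfolding triple_def
proof (intro allI impI)
  fix s assume s: "mem s = M" "agree (\<rho>I 0 @ \<rho>) s"
  \<comment> \<open>Truncated subtraction keeps the flag \<open>B - k\<close> nonzero exactly while
    \<open>k < B\<close>.\<close>
  define J where "J k s' \<longleftrightarrow> mem s' = M \<and> regs s' r = k \<and> regs s' f = B - k \<and>
    (\<forall>x. x \<notin> W \<union> {r, f} \<longrightarrow> regs s' x = regs s x) \<and> agree (\<rho>I k) s' \<and>
    outp s' = outp s @ concat (map g [0..<k])" for k s'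
  have \<rho>: "agree \<rho> s'" if "J k s'" for k s'
    by (rule agree_frame[of \<rho> s "W \<union> {r, f}"]) (use that s W in \<open>auto simp: J_def\<close>)
  have bW: "b \<notin> W" "b \<noteq> r" "b \<noteq> f" "r \<noteq> 1" "f \<noteq> 1" using b one W by force+
  let ?s1 = "s\<lparr>regs := (regs s)(r := 0)\<rparr>"
  let ?s2 = "?s1\<lparr>regs := (regs ?s1)(f := regs ?s1 b - regs ?s1 r)\<rparr>"
  have regb: "regs s b = B" using agreeD[OF _ b] s by simp
  have J0: "J 0 ?s2"
  proof -
    have "agree (\<rho>I 0) ?s2"
      by (rule agree_frame[of _ s "{r, f}"]) (use s W I[of 0] in auto)
    then show ?thesis using s regb bW W unfolding J_def by auto
  qed
  have "regs s' f \<noteq> 0 \<and>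
      (\<exists>t s''. exec (Seq c (Seq (Add r r 1) (Sub f b r))) s' t s'' \<and> t \<le> T + 2 \<and> J (Suc k) s'')"
    if k: "k < B" and J: "J k s'" for k s'
  proof -
    have "agree ((r, k) # \<rho>I k @ \<rho>) s'" using J \<rho> by (auto simp: J_def)
    then obtain t u where u: "exec c s' t u" "t \<le> T" "mem u = M" "\<forall>x. x \<notin> W \<longrightarrow> regs u x = regs s' x"
      "agree (\<rho>I (Suc k)) u" "outp u = outp s' @ g k"
      using body[OF k] J unfolding triple_def J_def by blast
    have "agree \<rho> u" by (rule agree_frame[of \<rho> s' W]) (use \<rho>[OF J] u W in auto)
    then have ub: "regs u b = B" "regs u 1 = 1" using agreeD b one by blast+
    have ur: "regs u r = k" using u W J by (auto simp: J_def)
    let ?u1 = "u\<lparr>regs := (regs u)(r := regs u r + regs u 1)\<rparr>"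
    let ?u2 = "?u1\<lparr>regs := (regs ?u1)(f := regs ?u1 b - regs ?u1 r)\<rparr>"
    have ex: "exec (Seq c (Seq (Add r r 1) (Sub f b r))) s' (t + (1 + 1)) ?u2"
      using u(1) by (intro exec.Seq[of _ _ t u] exec.Seq[of _ _ 1 ?u1] exec.Add exec.Sub)
    have "agree (\<rho>I (Suc k)) ?u2"
      by (rule agree_frame[of _ u "{r, f}"]) (use u W I[of "Suc k"] in auto)
    moreover have "outp ?u2 = outp s @ concat (map g [0..<Suc k])"
      using u J by (simp add: J_def)
    moreover have "\<forall>x. x \<notin> W \<union> {r, f} \<longrightarrow> regs ?u2 x = regs s x" using u(4) J by (simp add: J_def)
    moreover have "mem ?u2 = M" "regs ?u2 r = Suc k" "regs ?u2 f = B - Suc k"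
      using u(3) ub ur bW W(4) by simp_all
    ultimately have "J (Suc k) ?u2" unfolding J_def by blast
    moreover have "regs s' f \<noteq> 0" using J k by (simp add: J_def)
    moreover have "t + (1 + 1) \<le> T + 2" using u(2) by simp
    ultimately show ?thesis using ex by blast
  qed
  moreover have "regs s' f = 0" if "J B s'" for s' using that by (simp add: J_def)
  ultimately obtain t s' where w:
    "exec (While f (Seq c (Seq (Add r r 1) (Sub f b r)))) ?s2 t s'" "t \<le> B * (T + 2 + 1) + 1" "J B s'"
    using exec_While_invariant[of B J f _ "T + 2" ?s2] J0 by blast
  have ex: "exec (For r f b c) s (1 + (1 + t)) s'"
    unfolding For_def by (intro exec.Seq[of _ _ 1 ?s1] exec.Seq[of _ _ 1 ?s2] exec.Const exec.Sub w(1))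
  have "B * (T + 3) \<le> L * (T + 3)" using L by (rule mult_le_mono1)
  moreover have "T + 2 + 1 = T + 3" by simp
  ultimately have "1 + (1 + t) \<le> L * (T + 3) + 3" using w(2) by presburger
  with ex w(3) show "\<exists>t s'. exec (For r f b c) s t s' \<and> t \<le> L * (T + 3) + 3 \<and> mem s' = M \<and>
      (\<forall>x. x \<notin> W \<union> {r, f} \<longrightarrow> regs s' x = regs s x) \<and> agree (\<rho>I B) s' \<and>
      outp s' = outp s @ concat (map g [0..<B])"
    unfolding J_def by blast
qed

section \<open>Compiling Boolean tests into branches\<close>

datatype bexp = Less nat nat | Not bexp | And bexp bexp

fun bval :: "bexp \<Rightarrow> (nat \<Rightarrow> nat) \<Rightarrow> bool" where
  "bval (Less x y) v \<longleftrightarrow> v x < v y"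
| "bval (Not b) v \<longleftrightarrow> \<not> bval b v"
| "bval (And a b) v \<longleftrightarrow> bval a v \<and> bval b v"

fun bvars :: "bexp \<Rightarrow> nat set" where
  "bvars (Less x y) = {x, y}"
| "bvars (Not b) = bvars b"
| "bvars (And a b) = bvars a \<union> bvars b"

text \<open>Bounds the steps spent on a test: one subtraction and one conditional per comparison. A
  conjunction may stop earlier.\<close>

fun bdepth :: "bexp \<Rightarrow> nat" where
  "bdepth (Less x y) = 2"
| "bdepth (Not b) = bdepth b"
| "bdepth (And a b) = bdepth a + bdepth b"

text \<open>Register \<open>f\<close> is scratch space for the comparisons.\<close>

fun branch :: "nat \<Rightarrow> bexp \<Rightarrow> com \<Rightarrow> com \<Rightarrow> com" where
  "branch f (Less x y) c d = Seq (Sub f y x) (Cond f c d)"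
| "branch f (Not b) c d = branch f b d c"
| "branch f (And a b) c d = branch f a (branch f b c d) d"

lemma bval_cong: "(\<And>x. x \<in> bvars b \<Longrightarrow> v x = w x) \<Longrightarrow> bval b v = bval b w"
  by (induction b) auto

definition set_reg :: "nat \<Rightarrow> nat \<Rightarrow> state \<Rightarrow> state" where
  "set_reg r w s = s\<lparr>regs := (regs s)(r := w)\<rparr>"

lemma set_reg_simps [simp]:
  "regs (set_reg r w s) = (regs s)(r := w)" "mem (set_reg r w s) = mem s"
  "outp (set_reg r w s) = outp s" "set_reg r w (set_reg r v s) = set_reg r w s"
  by (auto simp: set_reg_def fun_eq_iff)

text \<open>A branch starts with whatever the last comparison left in the scratch register, hence
  the quantified \<open>w\<close>.\<close>

lemma exec_branch:
  assumes "f \<notin> bvars b"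
    and "\<And>w. bval b (regs s) \<Longrightarrow> \<exists>t s'. exec c (set_reg f w s) t s' \<and> t \<le> T \<and> Q s'"
    and "\<And>w. \<not> bval b (regs s) \<Longrightarrow> \<exists>t s'. exec d (set_reg f w s) t s' \<and> t \<le> T \<and> Q s'"
  shows "\<exists>t s'. exec (branch f b c d) s t s' \<and> t \<le> T + bdepth b \<and> Q s'"
  using assms
proof (induction b arbitrary: c d s T)
  case (Less x y)
  let ?s = "set_reg f (regs s y - regs s x) s"
  have sub: "exec (Sub f y x) s 1 ?s" unfolding set_reg_def by (rule exec.Sub)
  show ?case
  proof (cases "regs s x < regs s y")
    case True
    then obtain t s' where t: "exec c ?s t s'" "t \<le> T" "Q s'"
      using Less.prems(2)[of "regs s y - regs s x"] by auto
    then have "exec (Seq (Sub f y x) (Cond f c d)) s (1 + Suc t) s'"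
      using True by (intro exec.Seq[OF sub exec.CondTrue]) auto
    then show ?thesis using t by (intro exI[of _ "1 + Suc t"] exI[of _ s']) auto
  next
    case False
    then obtain t s' where t: "exec d ?s t s'" "t \<le> T" "Q s'"
      using Less.prems(3)[of "regs s y - regs s x"] by auto
    then have "exec (Seq (Sub f y x) (Cond f c d)) s (1 + Suc t) s'"
      using False by (intro exec.Seq[OF sub exec.CondFalse]) auto
    then show ?thesis using t by (intro exI[of _ "1 + Suc t"] exI[of _ s']) auto
  qed
next
  case (Not b)
  then show ?case by simp
next
  case (And a b)
  have b: "bval b ((regs s)(f := w)) = bval b (regs s)" for w
    using And.prems(1) by (intro bval_cong) auto
  have "\<exists>t s'. exec (branch f a (branch f b c d) d) s t s' \<and> t \<le> (T + bdepth b) + bdepth a \<and> Q s'"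
  proof (rule And.IH(1))
    show "f \<notin> bvars a" using And.prems(1) by simp
  next
    fix w assume a: "bval a (regs s)"
    show "\<exists>t s'. exec (branch f b c d) (set_reg f w s) t s' \<and> t \<le> T + bdepth b \<and> Q s'"
      by (rule And.IH(2)) (use And.prems a b b[unfolded fun_upd_def] in auto)
  next
    fix w assume "\<not> bval a (regs s)"
    then show "\<exists>t s'. exec d (set_reg f w s) t s' \<and> t \<le> T + bdepth b \<and> Q s'"
      using And.prems(3)[of w] trans_le_add1 by (metis bval.simps(3))
  qed
  then show ?case by (simp add: ac_simps)
qed

text \<open>Registers 1 and 4 hold 1 and 0, so they serve as the two output bits.\<close>

definition emit_bexp :: "nat \<Rightarrow> bexp \<Rightarrow> com" where
  "emit_bexp f b = branch f b (Emit 1) (Emit 4)"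

lemma triple_emit_bexp:
  assumes "f \<notin> bvars b" "f \<noteq> 1" "f \<noteq> 4" "(1, 1) \<in> set \<rho>" "(4, 0) \<in> set \<rho>"
    and v: "\<And>s. agree \<rho> s \<Longrightarrow> bval b (regs s) = \<beta>"
  shows "triple M \<rho> (emit_bexp f b) {f} [] [\<beta>] (1 + bdepth b)"
  unfolding triple_def emit_bexp_def
proof (intro allI impI)
  fix s assume s: "mem s = M" "agree \<rho> s"
  have r: "regs s 1 = 1" "regs s 4 = 0" using s assms(4,5) agreeD by blast+
  show "\<exists>t s'. exec (branch f b (Emit 1) (Emit 4)) s t s' \<and> t \<le> 1 + bdepth b \<and> mem s' = M \<and>
      (\<forall>x. x \<notin> {f} \<longrightarrow> regs s' x = regs s x) \<and> agree [] s' \<and> outp s' = outp s @ [\<beta>]"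
  proof (rule exec_branch)
    fix w assume "bval b (regs s)"
    then show "\<exists>t s'. exec (Emit 1) (set_reg f w s) t s' \<and> t \<le> 1 \<and> mem s' = M \<and>
        (\<forall>x. x \<notin> {f} \<longrightarrow> regs s' x = regs s x) \<and> agree [] s' \<and> outp s' = outp s @ [\<beta>]"
      using assms(2) r v[OF s(2)] s by - (intro exI conjI, rule exec.Emit, auto)
  next
    fix w assume "\<not> bval b (regs s)"
    then show "\<exists>t s'. exec (Emit 4) (set_reg f w s) t s' \<and> t \<le> 1 \<and> mem s' = M \<and>
        (\<forall>x. x \<notin> {f} \<longrightarrow> regs s' x = regs s x) \<and> agree [] s' \<and> outp s' = outp s @ [\<beta>]"
      using assms(3) r v[OF s(2)] s by - (intro exI conjI, rule exec.Emit, auto)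
  qed (rule assms(1))
qed

section \<open>Computing the subdivision\<close>

lemma concat_map_upt_mult:
  "concat (map g [0..<a * b]) = concat (map (\<lambda>i. concat (map (\<lambda>j. g (i * b + j)) [0..<b])) [0..<a])"
proof (induction a)
  case (Suc a)
  have "[a * b..<b + a * b] = map (\<lambda>j. j + a * b) [0..<b]" by (simp only: map_add_upt)
  then have "map g [a * b..<b + a * b] = map (\<lambda>j. g (a * b + j)) [0..<b]" by (simp add: add.commute)
  moreover have "[0..<b + a * b] = [0..<a * b] @ [a * b..<b + a * b]"
    by (metis add.commute le0 upt_add_eq_append)
  ultimately show ?case using Suc by simp
qed simp

text \<open>As \<open>code\<close> is lexicographic, one sweep over the vertex numbers is the same
  as the three nested loops of the program.\<close>

lemma concat_map_upt_code:
  "concat (map g [0..<n * n * L]) =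
    concat (map (\<lambda>i. concat (map (\<lambda>j. concat (map (\<lambda>t. g (code n L i j t)) [0..<L])) [0..<n])) [0..<n])"
  unfolding code_def
  by (subst concat_map_upt_mult, subst concat_map_upt_mult[of "\<lambda>i. concat (map (\<lambda>j. g (i * L + j)) [0..<L])"]) simp

text \<open>Expressing each entry through the single index \<open>i * n + j\<close> turns the nested
  lists into one \<open>map\<close>.\<close>

lemma enc_graph_nth:
  fixes n i j :: nat
  assumes "i < n" "j < n"
  shows "concat (map (\<lambda>i. map (\<lambda>j. f i j) [0..<n]) [0..<n]) ! (i * n + j) = f i j"
proof -
  have row: "map (\<lambda>j. f i j) [0..<n] =
      concat (map (\<lambda>j. [f ((i * n + j) div n) ((i * n + j) mod n)]) [0..<n])" for i
    by (simp only: concat_map_singleton) (auto intro!: map_cong)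
  have "concat (map (\<lambda>i. map (\<lambda>j. f i j) [0..<n]) [0..<n]) =
      concat (map (\<lambda>x. [f (x div n) (x mod n)]) [0..<n * n])"
    unfolding row by (rule concat_map_upt_mult[symmetric])
  also have "\<dots> = map (\<lambda>x. f (x div n) (x mod n)) [0..<n * n]" by (rule concat_map_singleton)
  finally have "concat (map (\<lambda>i. map (\<lambda>j. f i j) [0..<n]) [0..<n]) = map (\<lambda>x. f (x div n) (x mod n)) [0..<n * n]" .
  moreover have "i * n + j < n * n"
    using code_less[of i n j 0 1] assms by (simp add: code_def)
  ultimately show ?thesis using assms by simp
qed

text \<open>Seen from the inner vertex \<open>(i, j, t)\<close>, the neighbour is the next inner
  vertex, the start of the path if \<open>t = 0\<close>, or its end if \<open>t + 1 = L\<close>.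
  Only comparisons and successors occur, so the program can evaluate it.\<close>

definition next_on_path :: "nat \<Rightarrow> nat set set \<Rightarrow> nat \<Rightarrow> nat \<Rightarrow> nat \<Rightarrow> nat \<Rightarrow> nat \<Rightarrow> nat \<Rightarrow> bool" where
  "next_on_path L E i j t i' j' t' \<longleftrightarrow> i < j \<and> {i, j} \<in> E \<and>
    (i' = i \<and> j' = j \<and> t' = t + 1 \<or>
     t' = 0 \<and> (i' = i \<and> j' = i \<and> t = 0 \<or> i' = j \<and> j' = j \<and> t + 1 = L))"

text \<open>Every link has an inner end, and \<open>next_on_path\<close> describes it from there. On
  the first link of a path the inner end comes second, which swaps the roles.\<close>

lemma edge_subdivide_iff:
  assumes r: "i < n" "j < n" "t < L" "i' < n" "j' < n" "t' < L"
  shows "{code n L i j t, code n L i' j' t'} \<in> edges (subdivide n L E) \<longleftrightarrow>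
    next_on_path L E i j t i' j' t' \<or> next_on_path L E i' j' t' i j t"
proof -
  define dir where "dir v w \<longleftrightarrow> (\<exists>p\<in>arcs n E. \<exists>k\<le>L. v = node n L p k \<and> w = node n L p (Suc k))" for v w
  have 1: "next_on_path L E i j t i' j' t' \<or> next_on_path L E i' j' t' i j t" if d: "dir (code n L i j t) (code n L i' j' t')"
    and r: "i < n" "j < n" "t < L" "i' < n" "j' < n" "t' < L" for i j t i' j' t'
  proof -
    obtain p k where p: "p \<in> arcs n E" "k \<le> L" "code n L i j t = node n L p k"
      "code n L i' j' t' = node n L p (Suc k)" using d unfolding dir_def by blast
    have a: "fst p < snd p" "snd p < n" "fst p < n" "{fst p, snd p} \<in> E" using arcsD[OF p(1)] by auto
    consider "k = 0" | "0 < k" "k < L" | "0 < k" "k = L" using p(2) by linarith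
    then show ?thesis
    proof cases
      case 1
      then have "i = fst p \<and> j = fst p \<and> t = 0" "i' = fst p \<and> j' = snd p \<and> t' = 0"
        using p(3,4) r a by (auto simp: node_def code_inject)
      then show ?thesis using a by (simp add: next_on_path_def)
    next
      case 2
      then have "i = fst p \<and> j = snd p \<and> t = k - 1" "i' = fst p \<and> j' = snd p \<and> t' = k"
        using p(3,4) r a by (auto simp: node_def code_inject)
      then show ?thesis using a 2 by (simp add: next_on_path_def)
    next
      case 3
      then have "i = fst p \<and> j = snd p \<and> t = k - 1" "i' = snd p \<and> j' = snd p \<and> t' = 0"
        using p(3,4) r a by (auto simp: node_def code_inject)
      then show ?thesis using a 3 by (simp add: next_on_path_def)
    qed
  qed
  have 2: "dir (code n L i j t) (code n L i' j' t') \<or> dir (code n L i' j' t') (code n L i j t)" if d: "next_on_path L E i j t i' j' t'"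
    and r: "i < n" "j < n" "t < L" "i' < n" "j' < n" "t' < L" for i j t i' j' t'
  proof -
    have p: "(i, j) \<in> arcs n E" using d r by (simp add: arcs_def next_on_path_def)
    consider "i' = i" "j' = j" "t' = t + 1" | "i' = i" "j' = i" "t' = 0" "t = 0"
      | "i' = j" "j' = j" "t' = 0" "t + 1 = L" using d by (auto simp: next_on_path_def)
    then show ?thesis
    proof cases
      case 1
      then show ?thesis using r unfolding dir_def by (intro disjI1 bexI[OF _ p] exI[of _ "Suc t"]) (auto simp: node_def)
    next
      case 2
      then show ?thesis using r unfolding dir_def by (intro disjI2 bexI[OF _ p] exI[of _ 0]) (auto simp: node_def)
    next
      case 3
      then show ?thesis using r unfolding dir_def by (intro disjI1 bexI[OF _ p] exI[of _ "Suc t"]) (auto simp: node_def)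
    qed
  qed
  have "{code n L i j t, code n L i' j' t'} \<in> edges (subdivide n L E) \<longleftrightarrow> dir (code n L i j t) (code n L i' j' t') \<or> dir (code n L i' j' t') (code n L i j t)"
    unfolding dir_def subdivide_def graph.sel link_def doubleton_eq_iff mem_Collect_eq by blast
  then show ?thesis using 1[OF _ r] 1[OF _ r(4-6) r(1-3)] 2[OF _ r] 2[OF _ r(4-6) r(1-3)] by blast
qed

definition Eq :: "nat \<Rightarrow> nat \<Rightarrow> bexp" where "Eq x y = And (Not (Less x y)) (Not (Less y x))"
definition Or :: "bexp \<Rightarrow> bexp \<Rightarrow> bexp" where "Or a b = Not (And (Not a) (Not b))"

lemma bexp_simps [simp]:
  "bval (Eq x y) v \<longleftrightarrow> v x = v y" "bvars (Eq x y) = {x, y}"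
  "bval (Or a b) v \<longleftrightarrow> bval a v \<or> bval b v" "bvars (Or a b) = bvars a \<union> bvars b"
  by (auto simp: Eq_def Or_def)

text \<open>Registers during the main loop: 0 holds \<open>L\<close>, 1 holds 1, 2 holds \<open>n\<close>, 4 holds 0, and 3 is scratch
  space. The row \<open>(i, j, t)\<close> is kept in 5, 7, 9 and the column \<open>(i', j', t')\<close> in 11, 13, 15, with the loop
  flags in 6, 8, 10, 12, 14, 16. Registers 17 and 19 are running addresses into the input matrix, 18 and 20
  its entries at \<open>(i, j)\<close> and \<open>(i', j')\<close>, and 21 and 22 hold \<open>t + 1\<close> and \<open>t' + 1\<close>.\<close>

definition next_bexp ::
    "nat \<Rightarrow> nat \<Rightarrow> nat \<Rightarrow> nat \<Rightarrow> nat \<Rightarrow> nat \<Rightarrow> nat \<Rightarrow> nat \<Rightarrow> bexp" where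
  "next_bexp i j t e u i' j' t' = And (Less i j) (And (Less 4 e)
    (Or (And (Eq i' i) (And (Eq j' j) (Eq t' u)))
      (And (Eq t' 4) (Or (And (Eq i' i) (And (Eq j' i) (Eq t 4))) (And (Eq i' j) (And (Eq j' j) (Eq u 0)))))))"

text \<open>With register 0 holding \<open>L\<close> and register 4 holding 0,
  \<open>Less 4 e\<close> asks for the edge bit and \<open>Eq u 0\<close> for
  \<open>t + 1 = L\<close>.\<close>

definition adjacent_bexp :: bexp where
  "adjacent_bexp = Or (next_bexp 5 7 9 18 21 11 13 15) (next_bexp 11 13 15 20 22 5 7 9)"

text \<open>Recovers \<open>n\<close> as the address of the first zero, which ends the unary prefix
  of the input.\<close>

definition scan :: com where
  "scan = Seq (Const 2 0) (Seq (Load 3 2) (While 3 (Seq (Add 2 2 1) (Load 3 2))))"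

definition emit_unary :: com where
  "emit_unary = For 5 6 2 (For 7 8 2 (For 9 10 0 (Emit 1)))"

definition emit_bit :: com where
  "emit_bit = Seq (Add 22 15 1) (emit_bexp 3 adjacent_bexp)"

text \<open>The address in register 19 starts at the first matrix entry, \<open>n + 1\<close>, and
  advances once per pair \<open>(i', j')\<close>, so row-major addressing needs no
  multiplication.\<close>

definition emit_row :: com where
  "emit_row = Seq (Add 21 9 1) (Seq (Add 19 2 1)
    (For 11 12 2 (For 13 14 2 (Seq (Load 20 19) (Seq (For 15 16 0 emit_bit) (Add 19 19 1))))))"

definition emit_matrix :: com where
  "emit_matrix = Seq (Add 17 2 1)
    (For 5 6 2 (For 7 8 2 (Seq (Load 18 17) (Seq (For 9 10 0 emit_row) (Add 17 17 1)))))"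

text \<open>No instruction writes register 4; it is 0 initially, so \<open>Emit 4\<close> prints the
  separator between unary size and matrix.\<close>

definition reduction :: com where
  "reduction = Seq (Const 1 1) (Seq scan (Seq emit_unary (Seq (Emit 4) emit_matrix)))"

definition for_cost :: "nat \<Rightarrow> nat \<Rightarrow> nat" where
  "for_cost L T = L * (T + 3) + 3"

lemmas triple_For' = triple_For[folded for_cost_def]

lemma triple_scan:
  assumes M: "\<And>k. k < n \<Longrightarrow> M k \<noteq> 0" "M n = 0" and n: "n \<le> L"
  shows "triple M [(1, 1)] scan {2, 3} [(2, n)] [] (L * 3 + 3)"
  unfolding triple_def
proof (intro allI impI)
  fix s assume s: "mem s = M" "agree [(1, 1)] s"
  define I where "I k s' \<longleftrightarrow> mem s' = M \<and> (\<forall>x. x \<notin> {2, 3} \<longrightarrow> regs s' x = regs s x) \<and>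
    regs s' 2 = k \<and> regs s' 3 = M k \<and> outp s' = outp s" for k and s' :: state
  let ?s0 = "s\<lparr>regs := (regs s)(2 := 0)\<rparr>"
  let ?s = "?s0\<lparr>regs := (regs ?s0)(3 := mem ?s0 (regs ?s0 2))\<rparr>"
  have "regs u 3 \<noteq> 0 \<and> (\<exists>t s'. exec (Seq (Add 2 2 1) (Load 3 2)) u t s' \<and> t \<le> 2 \<and> I (Suc k) s')"
    if "k < n" "I k u" for k and u :: state
  proof -
    let ?u = "u\<lparr>regs := (regs u)(2 := regs u 2 + regs u 1)\<rparr>"
    let ?v = "?u\<lparr>regs := (regs ?u)(3 := mem ?u (regs ?u 2))\<rparr>"
    have "exec (Seq (Add 2 2 1) (Load 3 2)) u (1 + 1) ?v"
      by (intro exec.Seq[of _ _ 1 ?u] exec.Add exec.Load)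
    moreover have "I (Suc k) ?v" using that s by (simp add: I_def)
    moreover have "regs u 3 \<noteq> 0" using that M by (simp add: I_def)
    ultimately show ?thesis by (metis le_refl one_add_one)
  qed
  moreover have "regs u 3 = 0" if "I n u" for u using that M by (simp add: I_def)
  moreover have "I 0 ?s" using s by (simp add: I_def)
  ultimately obtain t s' where w: "exec (While 3 (Seq (Add 2 2 1) (Load 3 2))) ?s t s'" "t \<le> n * (2 + 1) + 1" "I n s'"
    using exec_While_invariant[of n I 3 _ 2 ?s] by blast
  have "exec scan s (1 + (1 + t)) s'"
    unfolding scan_def by (rule exec.Seq[OF exec.Const exec.Seq[OF exec.Load w(1)]])
  moreover have "1 + (1 + t) \<le> L * 3 + 3" using w(2) n by simp
  ultimately show "\<exists>t s'. exec scan s t s' \<and> t \<le> L * 3 + 3 \<and> mem s' = M \<and>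
      (\<forall>x. x \<notin> {2, 3} \<longrightarrow> regs s' x = regs s x) \<and> agree [(2, n)] s' \<and> outp s' = outp s @ []"
    using w(3) by (intro exI[of _ "1 + (1 + t)"] exI[of _ s']) (simp add: I_def)
qed

abbreviation row_cost :: "nat \<Rightarrow> nat" where
  "row_cost L \<equiv> 2 + for_cost L (for_cost L (2 + for_cost L (2 + bdepth adjacent_bexp)))"

definition total_cost :: "nat \<Rightarrow> nat" where
  "total_cost L = 1 + (L * 3 + 3 + (for_cost L (for_cost L (for_cost L 1)) +
    (1 + (1 + for_cost L (for_cost L (2 + for_cost L (row_cost L)))))))"

section \<open>Correctness and running time of the program\<close>

locale reduction_run =
  fixes n L :: nat and E :: "nat set set" and M :: "nat \<Rightarrow> nat"
  assumes n: "n \<le> L"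
    and M: "i < n \<Longrightarrow> j < n \<Longrightarrow> M (n + 1 + i * n + j) = of_bool ({i, j} \<in> E)"
begin

abbreviation fixed :: "(nat \<times> nat) list" where "fixed \<equiv> [(0, L), (1, 1), (2, n), (4, 0)]"

abbreviation bit :: "nat \<Rightarrow> nat \<Rightarrow> nat \<Rightarrow> nat \<Rightarrow> nat \<Rightarrow> nat \<Rightarrow> bool" where
  "bit i j t i' j' t' \<equiv> {code n L i j t, code n L i' j' t'} \<in> edges (subdivide n L E)"

abbreviation over_vertices :: "(nat \<Rightarrow> nat \<Rightarrow> nat \<Rightarrow> bool list) \<Rightarrow> bool list" where
  "over_vertices g \<equiv> concat (map (\<lambda>i. concat (map (\<lambda>j. concat (map (g i j) [0..<L])) [0..<n])) [0..<n])"

lemma emit_unary: "triple M fixed emit_unary {5, 6, 7, 8, 9, 10} []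
  (over_vertices (\<lambda>_ _ _. [True])) (for_cost L (for_cost L (for_cost L 1)))"
proof -
  have "triple M fixed (Emit 1) {} [] [True] 1" using triple_Emit[of 1 1 fixed M] by simp
  then have 1: "triple M ((9, t) # [] @ (7, j) # (5, i) # fixed) (Emit 1) {} [] [True] 1" for i j t
    by (rule triple_weaken) auto
  have 2: "triple M ([] @ (7, j) # (5, i) # fixed) (For 9 10 0 (Emit 1)) ({} \<union> {9, 10}) []
      (concat (map (\<lambda>_. [True]) [0..<L])) (for_cost L 1)" for i j
    by (rule triple_For'[where \<rho>I = "\<lambda>_. []"]) (use 1 in auto)
  have 3: "triple M ([] @ (5, i) # fixed) (For 7 8 2 (For 9 10 0 (Emit 1))) ({9, 10} \<union> {7, 8}) []
      (concat (map (\<lambda>j. concat (map (\<lambda>_. [True]) [0..<L])) [0..<n])) (for_cost L (for_cost L 1))" for i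
    by (rule triple_For'[where \<rho>I = "\<lambda>_. []"]) (use 2 n in auto)
  have 4: "triple M ([] @ fixed) emit_unary (({9, 10} \<union> {7, 8}) \<union> {5, 6}) []
      (over_vertices (\<lambda>_ _ _. [True])) (for_cost L (for_cost L (for_cost L 1)))"
    unfolding emit_unary_def
    by (rule triple_For'[where \<rho>I = "\<lambda>_. []"]) (use 3 n in auto)
  show ?thesis by (rule triple_weaken[OF 4]) auto
qed

text \<open>By \<open>edge_subdivide_iff\<close> the matrix entry is the value of the test. The
  assertion need only contain the listed facts, so the lemma fits below all enclosing loops.\<close>

lemma emit_bit:
  assumes "i < n" "j < n" "t < L" "i' < n" "j' < n" "t' < L"
    and \<rho>: "set [(15, t'), (13, j'), (11, i'), (20, of_bool ({i', j'} \<in> E)), (21, t + 1),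
      (9, t), (7, j), (5, i), (18, of_bool ({i, j} \<in> E)), (0, L), (1, 1), (2, n), (4, 0)] \<subseteq> set \<rho>"
      "fst ` set \<rho> \<inter> {3, 22} = {}"
  shows "triple M \<rho> emit_bit {3, 22} [] [bit i j t i' j' t'] (2 + bdepth adjacent_bexp)"
proof -
  have 1: "triple M \<rho> (Add 22 15 1) {22} [(22, t' + 1)] [] 1"
    by (rule triple_Add) (use \<rho>(1) in auto)
  have 2: "triple M ([(22, t' + 1)] @ \<rho>) (emit_bexp 3 adjacent_bexp) {3} [] [bit i j t i' j' t']
    (1 + bdepth adjacent_bexp)"
  proof (rule triple_emit_bexp)
    fix s assume s: "agree ([(22, t' + 1)] @ \<rho>) s"
    then have "agree \<rho> s" "regs s 22 = t' + 1" by auto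
    then have "regs s 15 = t'" "regs s 13 = j'" "regs s 11 = i'" "regs s 20 = of_bool ({i', j'} \<in> E)"
      "regs s 21 = t + 1" "regs s 9 = t" "regs s 7 = j" "regs s 5 = i" "regs s 18 = of_bool ({i, j} \<in> E)"
      "regs s 0 = L" "regs s 4 = 0" using \<rho>(1) by (auto simp: agree_def)
    then show "bval adjacent_bexp (regs s) = bit i j t i' j' t'"
      using \<open>regs s 22 = t' + 1\<close> unfolding edge_subdivide_iff[OF assms(1-6)]
      by (simp add: adjacent_bexp_def next_bexp_def next_on_path_def)
  qed (use \<rho>(1) in \<open>auto simp: adjacent_bexp_def next_bexp_def\<close>)
  show ?thesis unfolding emit_bit_def
    by (rule triple_weaken[OF triple_Seq[OF 1 2, unfolded append_Nil]]) (use \<rho>(2) in auto)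
qed

lemma emit_row:
  assumes "i < n" "j < n" "t < L"
    and \<rho>: "set [(9, t), (7, j), (5, i), (18, of_bool ({i, j} \<in> E)), (0, L), (1, 1), (2, n), (4, 0)] \<subseteq> set \<rho>"
      "fst ` set \<rho> \<inter> {3, 22, 15, 16, 19, 20, 13, 14, 11, 12, 21} = {}"
  shows "triple M \<rho> emit_row {3, 22, 15, 16, 19, 20, 13, 14, 11, 12, 21} []
    (over_vertices (\<lambda>i' j' t'. [bit i j t i' j' t'])) (row_cost L)"
proof -
  have a: "triple M \<rho> (Add 21 9 1) {21} [(21, t + 1)] [] 1" by (rule triple_Add) (use \<rho>(1) in auto)
  let ?\<rho> = "(21, t + 1) # \<rho>"
  have b: "triple M ?\<rho> (Add 19 2 1) {19} [(19, n + 1)] [] 1" by (rule triple_Add) (use \<rho>(1) in auto)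
  have body: "triple M ((13, j') # [(19, n + 1 + i' * n + j')] @ (11, i') # ?\<rho>)
      (Seq (Load 20 19) (Seq (For 15 16 0 emit_bit) (Add 19 19 1))) {3, 22, 15, 16, 19, 20}
      [(19, n + 1 + i' * n + Suc j')] (concat (map (\<lambda>t'. [bit i j t i' j' t']) [0..<L]))
      (2 + for_cost L (2 + bdepth adjacent_bexp))"
    if ij: "i' < n" "j' < n" for i' j'
  proof -
    let ?a = "n + 1 + i' * n + j'"
    let ?\<rho>1 = "(13, j') # [(19, ?a)] @ (11, i') # ?\<rho>"
    let ?\<rho>2 = "(20, of_bool ({i', j'} \<in> E)) # ?\<rho>1"
    have 1: "triple M ?\<rho>1 (Load 20 19) {20} [(20, of_bool ({i', j'} \<in> E))] [] 1"
      using triple_Load[of 19 ?a ?\<rho>1 M 20] M[OF ij] by simp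
    have 2: "triple M ([] @ ?\<rho>2) (For 15 16 0 emit_bit) ({3, 22} \<union> {15, 16}) []
        (concat (map (\<lambda>t'. [bit i j t i' j' t']) [0..<L])) (for_cost L (2 + bdepth adjacent_bexp))"
    proof (rule triple_For'[where \<rho>I = "\<lambda>_. []"])
      fix t' assume "t' < L"
      with assms(1-3) ij show "triple M ((15, t') # [] @ ?\<rho>2) emit_bit {3, 22} [] [bit i j t i' j' t']
          (2 + bdepth adjacent_bexp)"
        by (rule emit_bit) (use \<rho> in auto)
    qed (use \<rho> in auto)
    have 3: "triple M ([] @ ?\<rho>2) (Add 19 19 1) {19} [(19, ?a + 1)] [] 1"
      by (rule triple_Add) (use \<rho>(1) in auto)
    have 4: "triple M ([(20, of_bool ({i', j'} \<in> E))] @ ?\<rho>1) (Seq (For 15 16 0 emit_bit) (Add 19 19 1))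
      ({3, 22} \<union> {15, 16} \<union> {19}) [(19, ?a + 1)] (concat (map (\<lambda>t'. [bit i j t i' j' t']) [0..<L]) @ [])
      (for_cost L (2 + bdepth adjacent_bexp) + 1)"
      using triple_Seq[OF 2[unfolded append_Nil] 3] \<rho>(2) by auto
    show ?thesis
      by (rule triple_weaken[OF triple_Seq[OF 1 4, unfolded append_Nil append_Nil2]]) (use \<rho>(2) in auto)
  qed
  have loop_j: "triple M ([(19, n + 1 + i' * n + 0)] @ (11, i') # ?\<rho>)
      (For 13 14 2 (Seq (Load 20 19) (Seq (For 15 16 0 emit_bit) (Add 19 19 1))))
      ({3, 22, 15, 16, 19, 20} \<union> {13, 14}) [(19, n + 1 + i' * n + n)]
      (concat (map (\<lambda>j'. concat (map (\<lambda>t'. [bit i j t i' j' t']) [0..<L])) [0..<n]))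
      (for_cost L (2 + for_cost L (2 + bdepth adjacent_bexp)))"
    if "i' < n" for i'
    by (rule triple_For'[where \<rho>I = "\<lambda>j'. [(19, n + 1 + i' * n + j')]"])
      (use body that \<rho> n in auto)
  have loop_i: "triple M ([(19, n + 1 + 0 * n)] @ ?\<rho>)
      (For 11 12 2 (For 13 14 2 (Seq (Load 20 19) (Seq (For 15 16 0 emit_bit) (Add 19 19 1)))))
      ({3, 22, 15, 16, 19, 20, 13, 14} \<union> {11, 12}) [(19, n + 1 + n * n)]
      (over_vertices (\<lambda>i' j' t'. [bit i j t i' j' t']))
      (for_cost L (for_cost L (2 + for_cost L (2 + bdepth adjacent_bexp))))"
  proof (rule triple_For'[where \<rho>I = "\<lambda>i'. [(19, n + 1 + i' * n)]"])
    fix i' assume "i' < n"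
    \<comment> \<open>The address reached after row \<open>i'\<close> is the start of row
      \<open>Suc i'\<close>, so the inner loop restores the outer invariant.\<close>
    show "triple M ((11, i') # [(19, n + 1 + i' * n)] @ ?\<rho>)
        (For 13 14 2 (Seq (Load 20 19) (Seq (For 15 16 0 emit_bit) (Add 19 19 1))))
        {3, 22, 15, 16, 19, 20, 13, 14} [(19, n + 1 + Suc i' * n)]
        (concat (map (\<lambda>j'. concat (map (\<lambda>t'. [bit i j t i' j' t']) [0..<L])) [0..<n]))
        (for_cost L (2 + for_cost L (2 + bdepth adjacent_bexp)))"
      by (rule triple_weaken[OF loop_j[OF \<open>i' < n\<close>]]) auto
  qed (use \<rho> n in auto)
  have c: "triple M ([(19, n + 1)] @ ?\<rho>)
      (For 11 12 2 (For 13 14 2 (Seq (Load 20 19) (Seq (For 15 16 0 emit_bit) (Add 19 19 1)))))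
      {3, 22, 15, 16, 19, 20, 13, 14, 11, 12} []
      (over_vertices (\<lambda>i' j' t'. [bit i j t i' j' t']))
      (for_cost L (for_cost L (2 + for_cost L (2 + bdepth adjacent_bexp))))"
    by (rule triple_weaken[OF loop_i]) auto
  have "triple M ([(21, t + 1)] @ \<rho>) (Seq (Add 19 2 1)
      (For 11 12 2 (For 13 14 2 (Seq (Load 20 19) (Seq (For 15 16 0 emit_bit) (Add 19 19 1))))))
      ({19} \<union> {3, 22, 15, 16, 19, 20, 13, 14, 11, 12}) []
      ([] @ over_vertices (\<lambda>i' j' t'. [bit i j t i' j' t']))
      (1 + for_cost L (for_cost L (2 + for_cost L (2 + bdepth adjacent_bexp))))"
    using triple_Seq[OF b c] \<rho>(2) by auto
  from triple_Seq[OF a this, unfolded append_Nil] show ?thesis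
    unfolding emit_row_def by (rule triple_weaken) (use \<rho>(2) in auto)
qed

lemma emit_matrix: "triple M fixed emit_matrix {3, 22, 15, 16, 19, 20, 13, 14, 11, 12, 21, 9, 10, 17, 18, 7, 8, 5, 6} []
  (over_vertices (\<lambda>i j t. over_vertices (\<lambda>i' j' t'. [bit i j t i' j' t'])))
  (1 + for_cost L (for_cost L (2 + for_cost L (row_cost L))))"
proof -
  let ?W = "{3, 22, 15, 16, 19, 20, 13, 14, 11, 12, 21} :: nat set"
  let ?row = "\<lambda>i j t. over_vertices (\<lambda>i' j' t'. [bit i j t i' j' t'])"
  have body: "triple M ((7, j) # [(17, n + 1 + i * n + j)] @ (5, i) # fixed)
      (Seq (Load 18 17) (Seq (For 9 10 0 emit_row) (Add 17 17 1))) (?W \<union> {9, 10, 17, 18})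
      [(17, n + 1 + i * n + Suc j)] (concat (map (?row i j) [0..<L])) (2 + for_cost L (row_cost L))"
    if ij: "i < n" "j < n" for i j
  proof -
    let ?a = "n + 1 + i * n + j"
    let ?\<rho>1 = "(7, j) # [(17, ?a)] @ (5, i) # fixed"
    let ?\<rho>2 = "(18, of_bool ({i, j} \<in> E)) # ?\<rho>1"
    have 1: "triple M ?\<rho>1 (Load 18 17) {18} [(18, of_bool ({i, j} \<in> E))] [] 1"
      using triple_Load[of 17 ?a ?\<rho>1 M 18] M[OF ij] by simp
    have 2: "triple M ([] @ ?\<rho>2) (For 9 10 0 emit_row) (?W \<union> {9, 10}) []
        (concat (map (?row i j) [0..<L])) (for_cost L (row_cost L))"
    proof (rule triple_For'[where \<rho>I = "\<lambda>_. []"])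
      fix t assume "t < L"
      with ij show "triple M ((9, t) # [] @ ?\<rho>2) emit_row ?W [] (?row i j t) (row_cost L)"
        by (rule emit_row) auto
    qed auto
    have 3: "triple M ([] @ ?\<rho>2) (Add 17 17 1) {17} [(17, ?a + 1)] [] 1"
      by (rule triple_Add) auto
    have 4: "triple M ([(18, of_bool ({i, j} \<in> E))] @ ?\<rho>1) (Seq (For 9 10 0 emit_row) (Add 17 17 1))
      (?W \<union> {9, 10} \<union> {17}) [(17, ?a + 1)] (concat (map (?row i j) [0..<L]) @ []) (for_cost L (row_cost L) + 1)"
      using triple_Seq[OF 2[unfolded append_Nil] 3] by auto
    show ?thesis
      by (rule triple_weaken[OF triple_Seq[OF 1 4, unfolded append_Nil append_Nil2]]) auto
  qed
  have loop_j: "triple M ([(17, n + 1 + i * n + 0)] @ (5, i) # fixed)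
      (For 7 8 2 (Seq (Load 18 17) (Seq (For 9 10 0 emit_row) (Add 17 17 1))))
      (?W \<union> {9, 10, 17, 18} \<union> {7, 8}) [(17, n + 1 + i * n + n)]
      (concat (map (\<lambda>j. concat (map (?row i j) [0..<L])) [0..<n])) (for_cost L (2 + for_cost L (row_cost L)))"
    if "i < n" for i
    by (rule triple_For'[where \<rho>I = "\<lambda>j. [(17, n + 1 + i * n + j)]"]) (use body that n in auto)
  have loop_i: "triple M ([(17, n + 1 + 0 * n)] @ fixed)
      (For 5 6 2 (For 7 8 2 (Seq (Load 18 17) (Seq (For 9 10 0 emit_row) (Add 17 17 1)))))
      (?W \<union> {9, 10, 17, 18, 7, 8} \<union> {5, 6}) [(17, n + 1 + n * n)]
      (over_vertices ?row) (for_cost L (for_cost L (2 + for_cost L (row_cost L))))"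
  proof (rule triple_For'[where \<rho>I = "\<lambda>i. [(17, n + 1 + i * n)]"])
    fix i assume "i < n"
    show "triple M ((5, i) # [(17, n + 1 + i * n)] @ fixed)
        (For 7 8 2 (Seq (Load 18 17) (Seq (For 9 10 0 emit_row) (Add 17 17 1))))
        (?W \<union> {9, 10, 17, 18, 7, 8}) [(17, n + 1 + Suc i * n)]
        (concat (map (\<lambda>j. concat (map (?row i j) [0..<L])) [0..<n])) (for_cost L (2 + for_cost L (row_cost L)))"
      by (rule triple_weaken[OF loop_j[OF \<open>i < n\<close>]]) auto
  qed (use n in auto)
  have 1: "triple M fixed (Add 17 2 1) {17} [(17, n + 1)] [] 1" by (rule triple_Add) auto
  have 2: "triple M ([(17, n + 1)] @ fixed)
      (For 5 6 2 (For 7 8 2 (Seq (Load 18 17) (Seq (For 9 10 0 emit_row) (Add 17 17 1)))))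
      (?W \<union> {9, 10, 17, 18, 7, 8, 5, 6}) []
      (over_vertices ?row) (for_cost L (for_cost L (2 + for_cost L (row_cost L))))"
    by (rule triple_weaken[OF loop_i]) auto
  show ?thesis unfolding emit_matrix_def
    by (rule triple_weaken[OF triple_Seq[OF 1 2, unfolded append_Nil]]) auto
qed

lemma reduction:
  assumes "\<And>k. k < n \<Longrightarrow> M k \<noteq> 0" "M n = 0" "mem s = M" "regs s = (\<lambda>_. 0)(0 := L)" "outp s = []"
  shows "\<exists>t s'. exec reduction s t s' \<and> t \<le> total_cost L \<and>
    outp s' = enc_graph (subdivide n L E)"
proof -
  let ?bits = "over_vertices (\<lambda>i j t. over_vertices (\<lambda>i' j' t'. [bit i j t i' j' t']))"
  let ?W = "{3, 22, 15, 16, 19, 20, 13, 14, 11, 12, 21, 9, 10, 17, 18, 7, 8, 5, 6} :: nat set"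
  let ?T = "1 + for_cost L (for_cost L (2 + for_cost L (row_cost L)))"
  have 1: "triple M [(0, L), (4, 0)] (Const 1 1) {1} [(1, 1)] [] 1" by (rule triple_Const)
  have 2: "triple M ([(1, 1)] @ [(0, L), (4, 0)]) scan {2, 3} [(2, n)] [] (L * 3 + 3)"
    by (rule triple_weaken[OF triple_scan[of n M L, OF assms(1,2) n]]) auto
  have 4: "triple M ([] @ fixed) (Emit 4) {} [] [(0 :: nat) \<noteq> 0] 1" by (rule triple_Emit) auto
  have 5: "triple M ([] @ [] @ fixed) emit_matrix ?W [] ?bits ?T" using emit_matrix by simp
  have 45: "triple M ([] @ fixed) (Seq (Emit 4) emit_matrix) ({} \<union> ?W) [] ([(0 :: nat) \<noteq> 0] @ ?bits) (1 + ?T)"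
    by (rule triple_Seq[OF 4 5]) auto
  let ?out = "over_vertices (\<lambda>_ _ _. [True]) @ [(0 :: nat) \<noteq> 0] @ ?bits"
  have 345: "triple M fixed (Seq emit_unary (Seq (Emit 4) emit_matrix)) ({5, 6, 7, 8, 9, 10} \<union> ({} \<union> ?W)) []
      ?out (for_cost L (for_cost L (for_cost L 1)) + (1 + ?T))"
    by (rule triple_Seq[OF emit_unary 45]) auto
  have 345: "triple M ([(2, n)] @ [(1, 1)] @ [(0, L), (4, 0)]) (Seq emit_unary (Seq (Emit 4) emit_matrix)) ?W []
      ?out (for_cost L (for_cost L (for_cost L 1)) + (1 + ?T))"
    by (rule triple_weaken[OF 345]) auto
  have 6: "triple M ([(1, 1)] @ [(0, L), (4, 0)]) (Seq scan (Seq emit_unary (Seq (Emit 4) emit_matrix)))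
      ({2, 3} \<union> ?W) [] ([] @ ?out) (L * 3 + 3 + (for_cost L (for_cost L (for_cost L 1)) + (1 + ?T)))"
    by (rule triple_Seq[OF 2 345]) auto
  have "triple M [(0, L), (4, 0)] reduction ({1} \<union> ({2, 3} \<union> ?W)) [] ([] @ [] @ ?out) (total_cost L)"
    unfolding reduction_def total_cost_def by (rule triple_Seq[OF 1 6]) auto
  moreover have "agree [(0, L), (4, 0)] s" using assms(4) by simp
  ultimately obtain t s' where "exec reduction s t s'" "t \<le> total_cost L" "outp s' = outp s @ [] @ [] @ ?out"
    using assms(3) unfolding triple_def by blast
  moreover have "?out = enc_graph (subdivide n L E)"
  proof -
    have u: "replicate (n * n * L) True = over_vertices (\<lambda>_ _ _. [True])"
      by (subst concat_map_upt_code[of "\<lambda>_. [True]", symmetric]) (simp add: concat_map_singleton map_replicate_trivial)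
    have m: "concat (map (\<lambda>x. map (\<lambda>y. {x, y} \<in> edges (subdivide n L E)) [0..<n * n * L]) [0..<n * n * L]) = ?bits"
    proof -
      have "map (\<lambda>y. {x, y} \<in> edges (subdivide n L E)) [0..<n * n * L] =
          over_vertices (\<lambda>i' j' t'. [{x, code n L i' j' t'} \<in> edges (subdivide n L E)])" for x
        by (subst concat_map_upt_code[of "\<lambda>y. [{x, y} \<in> edges (subdivide n L E)]", symmetric])
          (simp only: concat_map_singleton)
      then show ?thesis by (simp only: concat_map_upt_code)
    qed
    have "card (verts (subdivide n L E)) = n * n * L" by (simp add: subdivide_def)
    then show ?thesis by (simp only: enc_graph_def Let_def u m) simp
  qed
  ultimately show ?thesis using assms(5) by auto
qed

end

section \<open>Input size, time bound and conclusion\<close>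

text \<open>The arcs and their mirror images are disjoint subsets of the \<open>n\<close> by
  \<open>n\<close> square.\<close>

lemma two_card_arcs: "2 * card (arcs n E) \<le> n * n"
proof -
  have fin: "finite (arcs n E)" by (rule finite_subset[of _ "{..<n} \<times> {..<n}"]) (auto simp: arcs_def)
  have "2 * card (arcs n E) = card (arcs n E) + card (prod.swap ` arcs n E)"
    by (simp add: card_image)
  also have "\<dots> = card (arcs n E \<union> prod.swap ` arcs n E)"
    using fin by (intro card_Un_disjoint[symmetric]) (auto simp: arcs_def)
  also have "\<dots> \<le> card ({..<n} \<times> {..<n})" by (rule card_mono) (auto simp: arcs_def)
  finally show ?thesis by simp
qed

text \<open>The summands are the unary size, the separator and the matrix. This bound yields
  \<open>0 < L\<close>, \<open>n \<le> L\<close> and enough links for all crossings.\<close>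

lemma length_enc_instance:
  assumes "verts G = {..<n}"
  shows "n + 1 + n * n \<le> length (enc_instance (G, k))"
  using assms by (simp add: enc_instance_def enc_graph_def Let_def length_concat comp_def sum_list_triv)

lemma enc_instance_memory:
  fixes k :: int
  assumes "verts G = {..<n}"
  defines "M \<equiv> mem (init_state (enc_instance (G, k)))"
  shows "x < n \<Longrightarrow> M x = 1" "M n = 0"
    "i < n \<Longrightarrow> j < n \<Longrightarrow> M (n + 1 + i * n + j) = of_bool ({i, j} \<in> edges G)"
proof -
  let ?A = "concat (map (\<lambda>i. map (\<lambda>j. {i, j} \<in> edges G) [0..<n]) [0..<n])"
  have enc: "enc_instance (G, k) = replicate n True @ False # ?A @ enc_int k"
    using assms(1) by (simp add: enc_instance_def enc_graph_def Let_def)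
  have lenA: "length ?A = n * n" by (simp add: length_concat comp_def sum_list_triv)
  show "x < n \<Longrightarrow> M x = 1" "M n = 0" by (simp_all add: M_def init_state_def enc nth_append)
  assume ij: "i < n" "j < n"
  then have l: "i * n + j < n * n" using code_less[of i n j 0 1] by (simp add: code_def)
  have "enc_instance (G, k) ! (n + 1 + i * n + j) = (?A @ enc_int k) ! (i * n + j)"
    unfolding enc by (simp add: nth_append add.assoc)
  also have "\<dots> = ({i, j} \<in> edges G)"
    using l lenA enc_graph_nth[OF ij, of "\<lambda>i j. {i, j} \<in> edges G"] by (simp add: nth_append)
  finally show "M (n + 1 + i * n + j) = of_bool ({i, j} \<in> edges G)"
    using length_enc_instance[OF assms(1), of k] l by (simp add: M_def init_state_def)
qed

definition for_cost_poly :: "nat poly \<Rightarrow> nat poly" where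
  "for_cost_poly p = [:0, 1:] * (p + [:3:]) + [:3:]"

lemma poly_for_cost_poly: "poly (for_cost_poly p) L = for_cost L (poly p L)"
  by (simp add: for_cost_poly_def for_cost_def)

text \<open>The cost is built from constants, sums and \<open>for_cost\<close>, each of which has a
  counterpart on polynomials.\<close>

lemma ex_poly_total_cost: "\<exists>p :: nat poly. \<forall>L. poly p L = total_cost L"
proof -
  define row where
    "row = [:2:] + for_cost_poly (for_cost_poly ([:2:] + for_cost_poly [:2 + bdepth adjacent_bexp:]))"
  define p where "p = [:1:] + ([:3, 3:] + (for_cost_poly (for_cost_poly (for_cost_poly [:1:])) +
    ([:1:] + ([:1:] + for_cost_poly (for_cost_poly ([:2:] + for_cost_poly row))))))"
  have "poly p L = total_cost L" for L
    unfolding p_def row_def total_cost_def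
    by (simp add: poly_for_cost_poly)
  then show ?thesis by blast
qed

text \<open>The graph depends on \<open>k\<close> through the length of the encoding; this is
  harmless, as the equivalence holds for every positive number of subdivisions.\<close>

definition subdivided_graph :: "nat graph \<times> int \<Rightarrow> nat graph" where
  "subdivided_graph x = subdivide (card (verts (fst x))) (length (enc_instance x)) (edges (fst x))"

lemma polytime_subdivided_graph:
  "polytime_computable enc_instance enc_graph {(G, k). labelled_graph G} subdivided_graph"
proof -
  obtain p :: "nat poly" where p: "\<And>L. poly p L = total_cost L"
    using ex_poly_total_cost by blast
  have "\<exists>t s. exec reduction (init_state (enc_instance x)) t s \<and> t \<le> poly p (length (enc_instance x)) \<and>
      outp s = enc_graph (subdivided_graph x)" if x: "x \<in> {(G, k). labelled_graph G}" for x
  proof -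
    obtain G k where Gk: "x = (G, k)" by (cases x)
    obtain n where vG: "verts G = {..<n}" using x Gk by (auto simp: labelled_graph_def)
    let ?L = "length (enc_instance x)" and ?s = "init_state (enc_instance x)"
    have len: "n + 1 + n * n \<le> ?L" unfolding Gk by (rule length_enc_instance[OF vG])
    interpret reduction_run n ?L "edges G" "mem ?s"
      by unfold_locales (use len enc_instance_memory[OF vG, where k = k] Gk in auto)
    have "subdivided_graph x = subdivide n ?L (edges G)"
      using vG Gk by (simp add: subdivided_graph_def)
    moreover have "\<exists>t s'. exec reduction ?s t s' \<and> t \<le> total_cost ?L \<and> outp s' = enc_graph (subdivide n ?L (edges G))"
    proof (rule reduction)
      show "regs ?s = (\<lambda>_. 0)(0 := ?L)" "outp ?s = []" by (simp_all add: init_state_def)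
    qed (use enc_instance_memory[OF vG, where k = k] Gk in auto)
    ultimately show ?thesis unfolding p by simp
  qed
  then show ?thesis unfolding polytime_computable_def by blast
qed

theorem theorem2:
  "\<exists>H :: nat graph \<times> int \<Rightarrow> nat graph.
     polytime_computable enc_instance enc_graph {(G, k). labelled_graph G} H \<and>
     (\<forall>G k. labelled_graph G \<longrightarrow>
        labelled_graph (H (G, k)) \<and> one_planar (H (G, k)) \<and>
        ((\<exists>S. feedback_vertex_set G S \<and> int (card S) \<le> k) \<longleftrightarrow>
         (\<exists>S. feedback_vertex_set (H (G, k)) S \<and> int (card S) \<le> k)))"
proof (intro exI[of _ subdivided_graph] conjI allI impI)
  show "polytime_computable enc_instance enc_graph {(G, k). labelled_graph G} subdivided_graph"
    by (rule polytime_subdivided_graph)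
next
  fix G k assume G: "labelled_graph G"
  then obtain n where n: "verts G = {..<n}" by (auto simp: labelled_graph_def)
  define L where "L = length (enc_instance (G, k))"
  have len: "n + 1 + n * n \<le> L" unfolding L_def by (rule length_enc_instance[OF n])
  then have L: "0 < L" by simp
  have H: "subdivided_graph (G, k) = subdivide n L (edges G)"
    using n by (simp add: subdivided_graph_def L_def)
  have G': "G = Graph {..<n} (edges G)" using n by (cases G) simp
  have simple: "simple_graph (Graph {..<n} (edges G))" using G G' by (simp add: labelled_graph_def)
  show "labelled_graph (subdivided_graph (G, k))"
    using simple_subdivide[OF L] unfolding H labelled_graph_def by (auto simp: subdivide_def)
  show "one_planar (subdivided_graph (G, k))"
    unfolding H using len two_card_arcs[of n "edges G"] by (intro one_planar_subdivide[OF L]) linarith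
  \<comment> \<open>Covers both the embedding and the projection of vertices; the bound
    \<open>m\<close> provides the finiteness of \<open>S\<close>.\<close>
  have card_le: "int (card (f ` S)) \<le> k" if "int (card S) \<le> k" "S \<subseteq> {..<m}" for f :: "nat \<Rightarrow> nat" and S m
    using that card_image_le[of S f] finite_subset[OF that(2)] by simp
  show "(\<exists>S. feedback_vertex_set G S \<and> int (card S) \<le> k) \<longleftrightarrow>
      (\<exists>S. feedback_vertex_set (subdivided_graph (G, k)) S \<and> int (card S) \<le> k)"
  proof
    assume "\<exists>S. feedback_vertex_set G S \<and> int (card S) \<le> k"
    then obtain S where S: "feedback_vertex_set G S" "int (card S) \<le> k" by blast
    then have "S \<subseteq> {..<n}" using n by (simp add: feedback_vertex_set_def)
    then show "\<exists>S. feedback_vertex_set (subdivided_graph (G, k)) S \<and> int (card S) \<le> k"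
      unfolding H using fvs_subdivide_imp[OF simple L, of S] S G' card_le by metis
  next
    assume "\<exists>S. feedback_vertex_set (subdivided_graph (G, k)) S \<and> int (card S) \<le> k"
    then obtain S where S: "feedback_vertex_set (subdivide n L (edges G)) S" "int (card S) \<le> k"
      unfolding H by blast
    then have "S \<subseteq> {..<n * n * L}" by (simp add: feedback_vertex_set_def subdivide_def)
    then show "\<exists>S. feedback_vertex_set G S \<and> int (card S) \<le> k"
      using fvs_of_subdivide[OF simple L S(1)] S(2) G' card_le by metis
  qed
qed

end
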